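(* Let $Z_1,Z_2,Z_3\in\mathbb R^2$ be the vertices of a (nondegenerate) triangle with $\|Z_1-Z_3\|=\|Z_2-Z_3\|$, and let $d_1,d_2,d_3>0$ with $d_1=d_2$. Put $r=\|Z_1-Z_2\|$, $s=\left\|Z_3-\frac{Z_1+Z_2}2\right\|$. Let $X$ be the set of global minimizers over $W\in\mathbb R^2$ of $O(W)=\sum_{j=1}^3\left|\,\|W-Z_j\|^2-d_j^2\right|$. With $h,R,M,P,T,d_3^*$ as in the context, $X$ is determined as follows. (A) For every $s\in(0,\infty)$: 1. $d_1\in\left(0,\sqrt{\frac{r^2}4+\frac{s^2}9}\right]$, $d_3\in\left(0,\frac{2s}3\right]$: $X=\{Y_0\}$; 2. $d_1\in\left(0,\sqrt{\frac{r^2}4+s^2}\right]$, $d_3\in[2s,\infty)$: $X=\{Y_3\}$; 3. $d_1\in\left(0,\frac r2\right]$, $d_3\in\left[\frac{2s}3,2s\right]$: $X=\{N_3\}$; 4. $d_1\in\left(\frac r2,\sqrt{\frac{r^2}4+\frac{s^2}9}\right]$, $d_3\in\left[\frac{2s}3,s-h\right]$: $X=\{N_3\}$; 5. $d_1\in\left(\frac r2,\sqrt{\frac{r^2}4+s^2}\right]$, $d_3\in[s+h,2s]$: $X=\{N_3\}$; 6. $d_1\in\left(\frac r2,\sqrt{\frac{r^2}4+\frac{s^2}9}\right)$, $d_3\in(s-h,s+h)$: $X=\{S_{23+},S_{31+}\}$; 7. $d_1\in\left[\sqrt{\frac{r^2}4+\frac{s^2}9},\infty\right)$, $d_3\in(0,|s-h|]$: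 $X=\{S_{12+}\}$; 8. $d_1\in\left[\sqrt{\frac{r^2}4+\frac{s^2}9},\sqrt{\frac{r^2}4+s^2}\right)$: $X=\{S_{12+}\}$ if $d_3\in[s-h,R)$; $X=\{S_{12+},S_{23+},S_{31+}\}$ if $d_3=R$; $X=\{S_{23+},S_{31+}\}$ if $d_3\in(R,s+h]$. (B) For $s\in\left(0,\frac{\sqrt3}2r\right)$: 1. $d_1\in\left[\sqrt{\frac{r^2}4+s^2},T\right)$: $X=\{S_{12+}\}$ if $d_3\in[h-s,R)$; $X=\{S_{12+},S_{23+},S_{31+}\}$ if $d_3=R$; $X=\{S_{23+},S_{31+}\}$ if $d_3\in(R,M)$; $X=\{S_{23+},S_{31+},S_{12-}\}$ if $d_3=M$; $X=\{S_{12-}\}$ if $d_3\in(M,\infty)$; 2. $d_1=T$: $X=\{S_{12+}\}$ if $d_3\in\left[h-s,\sqrt{h^2+s^2}\right)$; $X=\{S_{12+},S_{12-},S_{23+},S_{31+}\}$ if $d_3=\sqrt{h^2+s^2}$; $X=\{S_{12-}\}$ if $d_3\in\left(\sqrt{h^2+s^2},\infty\right)$; 3. $d_1\in(T,\infty)$: $X=\{S_{12+}\}$ if $d_3\in\left[h-s,\sqrt{h^2+s^2}\right)$; $X=\{S_{12+},S_{12-}\}$ if $d_3=\sqrt{h^2+s^2}$; $X=\{S_{12-}\}$ if $d_3\in\left(\sqrt{h^2+s^2},\infty\right)$. (C) For $s\in\left(\frac{\sqrt3}2r,\infty\right)$: 1. $d_1\in\left[\sqrt{\frac{r^2}4+s^2},P\right)$: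 $X=\{S_{12+}\}$ if $d_3\in[h-s,R)$; $X=\{S_{12+},S_{23+},S_{31+}\}$ if $d_3=R$; $X=\{S_{23+},S_{31+}\}$ if $d_3\in\left[R,\sqrt{h^2-s^2}\right)$; 2. $d_1=P$: $X=\{S_{12+}\}$ if $d_3\in\left[h-s,\sqrt{h^2-s^2}\right)$; $X=\{S_{12+},S_{23+},S_{23-},S_{31+},S_{31-}\}$ if $d_3=\sqrt{h^2-s^2}$; $X=\{S_{23+},S_{31+}\}$ if $d_3\in\left(\sqrt{h^2-s^2},\sqrt{h^2+s^2}\right]$; 3. $d_1\in(P,\infty)$: $X=\{S_{12+}\}$ if $d_3\in(h-s,d_3^* )$; $X=\{S_{12+},S_{23-},S_{31-}\}$ if $d_3=d_3^*$; $X=\{S_{23-},S_{31-}\}$ if $d_3\in\left(d_3^*,\sqrt{h^2+s^2}\right)$; $X=\{S_{23+},S_{23-},S_{31+},S_{31-}\}$ if $d_3=\sqrt{h^2+s^2}$; 4. $d_1\in\left[\sqrt{\frac{r^2}4+s^2},\infty\right)$: $X=\{S_{23+},S_{31+}\}$ if $d_3\in\left(\sqrt{h^2+s^2},M\right)$; $X=\{S_{23+},S_{31+},S_{12-}\}$ if $d_3=M$; $X=\{S_{12-}\}$ if $d_3\in(M,\infty)$.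
   Context: $S_j=\{W\in\mathbb R^2:\|W-Z_j\|=d_j\}$ and $S_{ij}=S_i\cap S_j$. If $\{i,j,k\}=\{1,2,3\}$ and $|S_{ij}|=2$, then $S_{ij+}$ and $S_{ij-}$ are the points of $S_{ij}$ at the shortest and the longest distance from $Z_k$, respectively; if $|S_{ij}|=1$, both denote the single point of $S_{ij}$. Listed points may coincide in boundary cases, and the displayed sets are understood as sets; only $d_3>0$ is considered. $Y_0=\frac13(Z_1+Z_2+Z_3)$, $Y_3=3Y_0-2Z_3=Z_1+Z_2-Z_3$, and $N_3=Z_3+d_3\frac{Y_3-Z_3}{\|Y_3-Z_3\|}$ (the point of $S_3$ closest to $Y_3$ in the cases where it occurs). Notation: for $d_1\ge\frac r2$, $h=\sqrt{d_1^2-\frac{r^2}4}$. $R>0$ and $M>0$ are defined (in the cases where they occur) by $$R^2=h^2+s^2\,\frac{4s^2+r^2}{4s^2+9r^2}-2sh\,\frac{4s^2-3r^2}{4s^2+9r^2},\qquad M^2=h^2+2sh\,\frac{4s^2-3r^2}{4s^2+r^2}+s^2\,\frac{4s^2+9r^2}{4s^2+r^2}.$$ For $s<\frac{\sqrt3}2r$, $T=\sqrt{\frac{r^2}4+s^2\left(\frac{4r^2}{3r^2-4s^2}\right)^2}$. For $s>\frac{\sqrt3}2r$, $P=\sqrt{\frac{r^2}4+s^2\left(\frac{4s^2+5r^2}{4s^2-3r^2}\right)^2}$. For $s>\frac{\sqrt3}2r$ and $d_1>P$, $d_3^*$ is the unique value of $d_3$ in the open interval $\left(h-s,\sqrt{h^2-s^2}\right)$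 (with $Z_1,Z_2,Z_3,d_1=d_2$ fixed) for which $O(S_{23-})=O(S_{12+})$.
   Formalization: In (C)3, {S23-,S31-} is shown on (d3*,√(h²−s²)), the four-point set at d3=√(h²−s²), and {S23+,S31+} on (√(h²−s²),√(h²+s²)]; the printed endpoint √(h²+s²) is false. In (C)1 the last interval, printed [R,√(h²−s²)) and empty, is (R,√(h²+s²)]. *)

theory Defs
  imports "HOL-Analysis.Analysis"
begin

definition objective ::
  "real^2 \<Rightarrow> real^2 \<Rightarrow> real^2 \<Rightarrow> real \<Rightarrow> real \<Rightarrow> real \<Rightarrow> real^2 \<Rightarrow> real" where
  "objective Z1 Z2 Z3 d1 d2 d3 W =
     \<bar>(norm (W - Z1))\<^sup>2 - d1\<^sup>2\<bar> + \<bar>(norm (W - Z2))\<^sup>2 - d2\<^sup>2\<bar> + \<bar>(norm (W - Z3))\<^sup>2 - d3\<^sup>2\<bar>"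

definition minimizers ::
  "real^2 \<Rightarrow> real^2 \<Rightarrow> real^2 \<Rightarrow> real \<Rightarrow> real \<Rightarrow> real \<Rightarrow> (real^2) set" where
  "minimizers Z1 Z2 Z3 d1 d2 d3 =
     {W. \<forall>V. objective Z1 Z2 Z3 d1 d2 d3 W \<le> objective Z1 Z2 Z3 d1 d2 d3 V}"

(* The point of the intersection of two circles nearest to (resp. farthest from) C.  If the
   circles meet in exactly one point, both are that point.  They are unspecified when the circles
   do not meet, or when they meet in two points equidistant from C, which for distinct A and B
   means that C is collinear with A and B. *)

definition near_point :: "real^2 \<Rightarrow> real \<Rightarrow> real^2 \<Rightarrow> real \<Rightarrow> real^2 \<Rightarrow> real^2" where
  "near_point A a B b C =
     (THE W. W \<in> sphere A a \<inter> sphere B b \<and> (\<forall>V \<in> sphere A a \<inter> sphere B b. dist W C \<le> dist V C))"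

definition far_point :: "real^2 \<Rightarrow> real \<Rightarrow> real^2 \<Rightarrow> real \<Rightarrow> real^2 \<Rightarrow> real^2" where
  "far_point A a B b C =
     (THE W. W \<in> sphere A a \<inter> sphere B b \<and> (\<forall>V \<in> sphere A a \<inter> sphere B b. dist V C \<le> dist W C))"

(* In the threshold functions below, r is the base and s the height of the isosceles triangle. *)

definition thr_h :: "real \<Rightarrow> real \<Rightarrow> real" where
  "thr_h r d1 = sqrt (d1\<^sup>2 - r\<^sup>2 / 4)"

(* The radicands of thr_R and thr_M are positive for r, s > 0: as quadratic polynomials
   in thr_h r d1 they have negative discriminant. *)

definition thr_R :: "real \<Rightarrow> real \<Rightarrow> real \<Rightarrow> real" where
  "thr_R r s d1 =
     sqrt ((thr_h r d1)\<^sup>2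
           + s\<^sup>2 * ((4 * s\<^sup>2 + r\<^sup>2) / (4 * s\<^sup>2 + 9 * r\<^sup>2))
           - 2 * s * thr_h r d1 * ((4 * s\<^sup>2 - 3 * r\<^sup>2) / (4 * s\<^sup>2 + 9 * r\<^sup>2)))"

definition thr_M :: "real \<Rightarrow> real \<Rightarrow> real \<Rightarrow> real" where
  "thr_M r s d1 =
     sqrt ((thr_h r d1)\<^sup>2
           + 2 * s * thr_h r d1 * ((4 * s\<^sup>2 - 3 * r\<^sup>2) / (4 * s\<^sup>2 + r\<^sup>2))
           + s\<^sup>2 * ((4 * s\<^sup>2 + 9 * r\<^sup>2) / (4 * s\<^sup>2 + r\<^sup>2)))"

definition thr_T :: "real \<Rightarrow> real \<Rightarrow> real" where
  "thr_T r s = sqrt (r\<^sup>2 / 4 + s\<^sup>2 * (4 * r\<^sup>2 / (3 * r\<^sup>2 - 4 * s\<^sup>2))\<^sup>2)"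

definition thr_P :: "real \<Rightarrow> real \<Rightarrow> real" where
  "thr_P r s = sqrt (r\<^sup>2 / 4 + s\<^sup>2 * ((4 * s\<^sup>2 + 5 * r\<^sup>2) / (4 * s\<^sup>2 - 3 * r\<^sup>2))\<^sup>2)"

(* With d1 = d2 fixed, the third radius x at which the far point of the circles around Z2, Z3
   and the near point of the circles around Z1, Z2 have equal objective values.  Both the
   objective and the far point depend on x. *)

definition d3_star :: "real^2 \<Rightarrow> real^2 \<Rightarrow> real^2 \<Rightarrow> real \<Rightarrow> real" where
  "d3_star Z1 Z2 Z3 d1 =
     (let s = norm (Z3 - (1/2) *\<^sub>R (Z1 + Z2));
          h = thr_h (norm (Z1 - Z2)) d1
      in THE x. x \<in> {h - s<..<sqrt (h\<^sup>2 - s\<^sup>2)} \<and>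
           objective Z1 Z2 Z3 d1 d1 x (far_point Z2 d1 Z3 x Z1) =
           objective Z1 Z2 Z3 d1 d1 x (near_point Z1 d1 Z2 d1 Z3))"

end

(* Put the base of the triangle on the x-axis, symmetrically, and the apex at (0, s). With
   u = x^2 + y^2 - h^2 and v = |W - Z3|^2 - d3^2 the objective becomes 2 max(|u|, r|x|) + |v|.

   If a minimizer lies on the axis and the multipliers of the three absolute values have a
   positive sum, the corresponding combination of the quadratics is a strictly convex lower
   bound touching the objective there, so the minimizer is unique.

   Otherwise |h - s| < d3 < h + s. In the coordinates (u, v) the function x^2 is a concave
   quadratic. For m at most the values at the points S_ij it is at least (m/2r)^2 at the vertices
   (+-m/2, 0) of the rhombus 2|u| + |v| <= m and nonnegative at (0, +-m). By Jensen's inequality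
   4 r^2 x^2 >= m (m - |v|) >= (m - |v|)^2 inside the rhombus, so the objective is at least m, with
   equality only at the vertices, that is, at the points S_ij. It remains to compare their values:
   those of S_23 and S_31 are 2r times positive roots of quadratics, and each comparison turns
   out to be linear in c = h^2 + s^2 - d3^2. *)

theory Submission
  imports Defs
begin

section \<open>Concavity on the rhombus\<close>

text \<open>A strictly convex lower bound yields a single minimizer, so it cannot serve where the
  distinct mirror images S23+ and S31+ are optimal together; Jensen takes its place there. Since 2 s
  y = c + u - v is linear in (u, v), the function x^2 = u + h^2 - y^2 is concave. Only |x| enters
  the objective, so losing the sign of x costs nothing. Looking at the rhombus suffices because the
  objective is at least 2|u| + |v| everywhere, and an optimal vertex is a candidate: v = 0 with |u|
  = r|x| describes S23 and S31, u = 0 with x = 0 describes S12. The comparisons become linear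
  because the constant term 4 s^2 h^2 - c^2 of the quadratics is the product of 2hs - c and 2hs + c,
  the values at S12+ and S12-: inserting one of them for the unknown lets it cancel as a factor. T
  and P are the radii at which two ties merge: for T those of the near pair with S12+ and with S12-,
  for P those of S12+ with the near pair and with the far pair.\<close>

lemma abs_add_abs_diff: "\<bar>u + w\<bar> + \<bar>u - w\<bar> = 2 * max \<bar>u\<bar> \<bar>w\<bar>" for u w :: real
  by (auto simp: max_def abs_if)

text \<open>Write G(u, v) for 4 s^2 x^2 as a function of u and v. Then \<open>a\<close> and
  \<open>b\<close> give G >= 0 at (0, m) and (0, -m), while \<open>q\<close> says G >= (2 s t / r)^2
  at (t, 0) with |t| = m/2. The second conclusion is the equality case, which later identifies the
  minimizers.\<close>

lemma rhombus_bound: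
  fixes r s h c x y m :: real
  defines "u \<equiv> x\<^sup>2 + y\<^sup>2 - h\<^sup>2"
  defines "v \<equiv> u + c - 2 * s * y"
  assumes r: "r > 0" and s: "s > 0" and m: "m > 0"
    and a: "m \<le> 2 * h * s - c" and b: "m \<le> 2 * h * s + c"
    and q: "\<And>t. \<bar>t\<bar> = m / 2 \<Longrightarrow> 4 * s\<^sup>2 * t\<^sup>2 \<le> r\<^sup>2 * (4 * s\<^sup>2 * h\<^sup>2 + 4 * s\<^sup>2 * t - (c + t)\<^sup>2)"
    and uv: "2 * \<bar>u\<bar> + \<bar>v\<bar> \<le> m"
  shows "m \<le> 2 * r * \<bar>x\<bar> + \<bar>v\<bar>"
    and "2 * r * \<bar>x\<bar> + \<bar>v\<bar> \<le> m \<Longrightarrow> v = 0 \<and> \<bar>u\<bar> = m / 2 \<or> u = 0 \<and> \<bar>v\<bar> = m"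
proof -
  define G where "G = (\<lambda>u v. 4 * s\<^sup>2 * h\<^sup>2 + 4 * s\<^sup>2 * u - (c + u - v)\<^sup>2)"
  \<comment> \<open>The point (u, v) is the mean of the vertices (m/2, 0), (-m/2, 0) and (0, m) or
    (0, -m) with weights (m - |v| + 2u)/(2m), (m - |v| - 2u)/(2m) and |v|/m. As the quadratic part
    of G is -(u - v)^2, the exact Jensen gap is the variance of u - v under these weights, which is
    \<open>var\<close>.\<close>
  define var where "var = m * (m + 3 * \<bar>v\<bar>) / 4 - (u - v)\<^sup>2"
  have Gx: "4 * s\<^sup>2 * x\<^sup>2 = G u v"
    unfolding G_def v_def by (simp add: u_def algebra_simps power2_eq_square)
  have q1: "s\<^sup>2 * m\<^sup>2 \<le> r\<^sup>2 * G (m/2) 0" and q2: "s\<^sup>2 * m\<^sup>2 \<le> r\<^sup>2 * G (-(m/2)) 0"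
    using q[of "m/2"] q[of "-(m/2)"] m by (simp_all add: G_def power_divide)
  have q3: "0 \<le> r\<^sup>2 * G 0 (if v \<ge> 0 then m else - m)"
  proof -
    have "(c - m)\<^sup>2 \<le> (2 * h * s)\<^sup>2" "(c + m)\<^sup>2 \<le> (2 * h * s)\<^sup>2"
      using a b m by (auto intro!: power2_le_iff_abs_le[THEN iffD2])
    then show ?thesis by (simp add: G_def power_mult_distrib mult_ac)
  qed
  have jensen: "m * (r\<^sup>2 * G u v) =
      (m - \<bar>v\<bar> + 2 * u) / 2 * (r\<^sup>2 * G (m/2) 0) + (m - \<bar>v\<bar> - 2 * u) / 2 * (r\<^sup>2 * G (-(m/2)) 0)
      + \<bar>v\<bar> * (r\<^sup>2 * G 0 (if v \<ge> 0 then m else - m)) + m * r\<^sup>2 * var"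
    unfolding G_def var_def by (simp add: abs_if field_simps power2_eq_square)
  have "(m - \<bar>v\<bar> + 2 * u) / 2 * (s\<^sup>2 * m\<^sup>2) \<le> (m - \<bar>v\<bar> + 2 * u) / 2 * (r\<^sup>2 * G (m/2) 0)"
    using uv by (intro mult_left_mono[OF q1]) auto
  moreover have "(m - \<bar>v\<bar> - 2 * u) / 2 * (s\<^sup>2 * m\<^sup>2) \<le> (m - \<bar>v\<bar> - 2 * u) / 2 * (r\<^sup>2 * G (-(m/2)) 0)"
    using uv by (intro mult_left_mono[OF q2]) auto
  moreover have "0 \<le> \<bar>v\<bar> * (r\<^sup>2 * G 0 (if v \<ge> 0 then m else - m))"
    using q3 by simp
  ultimately have "(m - \<bar>v\<bar>) * (s\<^sup>2 * m\<^sup>2) + m * r\<^sup>2 * var \<le> m * (r\<^sup>2 * G u v)"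
    unfolding jensen by (simp add: field_simps)
  then have "m * ((m - \<bar>v\<bar>) * s\<^sup>2 * m + r\<^sup>2 * var) \<le> m * (r\<^sup>2 * G u v)"
    by (simp add: algebra_simps power2_eq_square)
  then have main: "(m - \<bar>v\<bar>) * s\<^sup>2 * m + r\<^sup>2 * var \<le> s\<^sup>2 * (2 * r * x)\<^sup>2"
    using m by (simp add: Gx[symmetric] power_mult_distrib mult_ac)
  have var: "0 \<le> var"
  proof -
    have "\<bar>u - v\<bar> \<le> \<bar>(m + \<bar>v\<bar>) / 2\<bar>"
      using uv m abs_triangle_ineq4[of u v] by simp
    then have "(u - v)\<^sup>2 \<le> ((m + \<bar>v\<bar>) / 2)\<^sup>2" by (rule abs_le_square_iff[THEN iffD1])
    moreover have "m * (m + 3 * \<bar>v\<bar>) / 4 - ((m + \<bar>v\<bar>) / 2)\<^sup>2 = \<bar>v\<bar> * (m - \<bar>v\<bar>) / 4"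
      by (simp add: power2_eq_square field_simps)
    moreover have "0 \<le> \<bar>v\<bar> * (m - \<bar>v\<bar>)" using uv by (intro mult_nonneg_nonneg) auto
    ultimately show ?thesis unfolding var_def by linarith
  qed
  \<comment> \<open>The split m (m - |v|) = (m - |v|)^2 + |v| (m - |v|) isolates a second
    nonnegative slack. In the equality case both slacks vanish: one forces v = 0 or |v| = m, the
    other then fixes u.\<close>
  have "s\<^sup>2 * (m - \<bar>v\<bar>)\<^sup>2 + s\<^sup>2 * (\<bar>v\<bar> * (m - \<bar>v\<bar>)) + r\<^sup>2 * var \<le> s\<^sup>2 * (2 * r * x)\<^sup>2"
    using main by (simp add: algebra_simps power2_eq_square)
  moreover have v: "0 \<le> s\<^sup>2 * (\<bar>v\<bar> * (m - \<bar>v\<bar>))" "0 \<le> r\<^sup>2 * var"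
    using uv var by auto
  ultimately have sq: "s\<^sup>2 * (m - \<bar>v\<bar>)\<^sup>2 \<le> s\<^sup>2 * (2 * r * x)\<^sup>2"
    and sq': "s\<^sup>2 * (2 * r * x)\<^sup>2 \<le> s\<^sup>2 * (m - \<bar>v\<bar>)\<^sup>2 \<Longrightarrow> s\<^sup>2 * (\<bar>v\<bar> * (m - \<bar>v\<bar>)) = 0 \<and> r\<^sup>2 * var = 0"
    by linarith+
  from sq have "\<bar>m - \<bar>v\<bar>\<bar> \<le> \<bar>2 * r * x\<bar>" using s by (simp add: abs_le_square_iff)
  then show "m \<le> 2 * r * \<bar>x\<bar> + \<bar>v\<bar>" using r by (simp add: abs_mult)
  assume "2 * r * \<bar>x\<bar> + \<bar>v\<bar> \<le> m"
  then have "\<bar>2 * r * x\<bar> \<le> \<bar>m - \<bar>v\<bar>\<bar>" using r by (simp add: abs_mult)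
  then have "\<bar>v\<bar> * (m - \<bar>v\<bar>) = 0" "var = 0"
    using sq' r s by (auto simp: abs_le_square_iff)
  then consider "v = 0" "var = 0" | "\<bar>v\<bar> = m" by auto
  then show "v = 0 \<and> \<bar>u\<bar> = m / 2 \<or> u = 0 \<and> \<bar>v\<bar> = m"
  proof cases
    case 1
    then have "u\<^sup>2 = (m/2)\<^sup>2" by (simp add: var_def power2_eq_square)
    then have "\<bar>u\<bar> = \<bar>m/2\<bar>" using power2_eq_iff by (metis abs_minus)
    then show ?thesis using 1 m by simp
  qed (use uv in auto)
qed

text \<open>The larger root of a x^2 + 2 b x - c. For a > 0 and c >= 0 the two roots do not have the
  same strict sign, and negating b negates both of them, so the smaller root is
  \<open>- pos_root a (- b) c\<close>.\<close>

definition pos_root :: "real \<Rightarrow> real \<Rightarrow> real \<Rightarrow> real" where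
  "pos_root a b c = (- b + sqrt (b\<^sup>2 + a * c)) / a"

lemma pos_root_quadratic:
  assumes "a > 0" "c \<ge> 0"
  shows "a * x\<^sup>2 + 2 * b * x - c = a * (x - pos_root a b c) * (x + pos_root a (- b) c)"
proof -
  have "(sqrt (b\<^sup>2 + a * c))\<^sup>2 = b\<^sup>2 + a * c" using assms by simp
  then show ?thesis using assms unfolding pos_root_def
    by (simp add: field_simps power2_eq_square)
qed

lemma pos_root_nonneg: "a > 0 \<Longrightarrow> c \<ge> 0 \<Longrightarrow> 0 \<le> pos_root a b c"
  unfolding pos_root_def by (auto intro!: divide_nonneg_pos real_le_rsqrt)

lemma pos_root_pos:
  assumes "a > 0" "c > 0" shows "0 < pos_root a b c"
proof -
  have "b < sqrt (b\<^sup>2 + a * c)" using assms by (intro real_less_rsqrt) auto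
  then show ?thesis using assms by (simp add: pos_root_def)
qed

lemma pos_root_zero: "a > 0 \<Longrightarrow> b \<ge> 0 \<Longrightarrow> pos_root a b 0 = 0"
  by (simp add: pos_root_def)

text \<open>At x > 0 the factor belonging to the negative root is positive, so the sign of the
  quadratic alone decides. All later comparisons thereby avoid square roots.\<close>

lemma pos_root_compare:
  assumes "a > 0" "c > 0" "x > 0"
  shows "pos_root a b c < x \<longleftrightarrow> 0 < a * x\<^sup>2 + 2 * b * x - c"
    and "pos_root a b c = x \<longleftrightarrow> a * x\<^sup>2 + 2 * b * x - c = 0"
proof -
  have "0 < x + pos_root a (- b) c" using pos_root_pos[of a c "- b"] assms by simp
  then show "pos_root a b c < x \<longleftrightarrow> 0 < a * x\<^sup>2 + 2 * b * x - c"
    "pos_root a b c = x \<longleftrightarrow> a * x\<^sup>2 + 2 * b * x - c = 0"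
    using assms by (auto simp: pos_root_quadratic zero_less_mult_iff)
qed

section \<open>Coordinates\<close>

text \<open>The alternative V = W admits circles that touch in one point; strictness for every other
  V is what makes the \<open>THE\<close> description unique.\<close>

lemma near_pointI:
  assumes "W \<in> sphere A a \<inter> sphere B b"
    and "\<And>V. V \<in> sphere A a \<inter> sphere B b \<Longrightarrow> V = W \<or> dist W Q < dist V Q"
  shows "near_point A a B b Q = W"
  unfolding near_point_def
proof (rule the_equality)
  show "W \<in> sphere A a \<inter> sphere B b \<and> (\<forall>V\<in>sphere A a \<inter> sphere B b. dist W Q \<le> dist V Q)"
    using assms by (metis order.strict_implies_order order_refl)
qed (use assms in \<open>metis not_le\<close>)

lemma far_pointI:
  assumes "W \<in> sphere A a \<inter> sphere B b"
    and "\<And>V. V \<in> sphere A a \<inter> sphere B b \<Longrightarrow> V = W \<or> dist V Q < dist W Q"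
  shows "far_point A a B b Q = W"
  unfolding far_point_def
proof (rule the_equality)
  show "W \<in> sphere A a \<inter> sphere B b \<and> (\<forall>V\<in>sphere A a \<inter> sphere B b. dist V Q \<le> dist W Q)"
    using assms by (metis order.strict_implies_order order_refl)
qed (use assms in \<open>metis not_le\<close>)

lemma minimizers_eq_sublevel:
  assumes "\<And>V. m \<le> objective Z1 Z2 Z3 d1 d2 d3 V" and "objective Z1 Z2 Z3 d1 d2 d3 W \<le> m"
  shows "minimizers Z1 Z2 Z3 d1 d2 d3 = {V. objective Z1 Z2 Z3 d1 d2 d3 V \<le> m}"
  unfolding minimizers_def using assms by (auto intro: order_trans)

lemma orthonormal_expansion:
  fixes f g W :: "real^2"
  assumes "f \<bullet> f = 1" "g \<bullet> g = 1" "f \<bullet> g = 0"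
  shows "W = (W \<bullet> f) *\<^sub>R f + (W \<bullet> g) *\<^sub>R g"
proof -
  have f: "f$1 * f$1 + f$2 * f$2 = 1" and g: "g$1 * g$1 + g$2 * g$2 = 1"
    and fg: "f$1 * g$1 + f$2 * g$2 = 0"
    using assms by (simp_all add: inner_vec_def sum_2)
  \<comment> \<open>The determinant of the pair. Orthonormality makes g the vector f turned by a
    right angle, times e with e^2 = 1, so both orientations are covered at once.\<close>
  define e where "e = f$1 * g$2 - f$2 * g$1"
  have g1: "g$1 = - e * f$2" and g2: "g$2 = e * f$1"
    using f fg unfolding e_def by algebra+
  have e: "e * e = 1" using f g unfolding g1 g2 by algebra
  have "W$1 = (W \<bullet> f) * f$1 + (W \<bullet> g) * g$1" "W$2 = (W \<bullet> f) * f$2 + (W \<bullet> g) * g$2"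
    unfolding inner_vec_def sum_2 inner_real_def g1 g2 using e f by algebra+
  then show ?thesis by (simp add: vec_eq_iff forall_2)
qed

text \<open>A triangle in arbitrary position is handled by an orthonormal frame at the midpoint of
  its base, so no isometry has to be carried through \<open>minimizers\<close>,
  \<open>near_point\<close> and \<open>far_point\<close>. The orientation of (f, g) is left
  open.\<close>

locale isosceles_frame =
  fixes mid f g :: "real^2" and r s :: real
  assumes orthonormal: "f \<bullet> f = 1" "g \<bullet> g = 1" "f \<bullet> g = 0"
    and r_pos: "r > 0" and s_pos: "s > 0"
begin

definition pt :: "real \<Rightarrow> real \<Rightarrow> real^2" where
  "pt x y = mid + x *\<^sub>R f + y *\<^sub>R g"

abbreviation "Z1 \<equiv> pt (- (r / 2)) 0"
abbreviation "Z2 \<equiv> pt (r / 2) 0"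
abbreviation "Z3 \<equiv> pt 0 s"

lemma pt_surj: obtains x y where "W = pt x y"
proof (rule that)
  show "W = pt ((W - mid) \<bullet> f) ((W - mid) \<bullet> g)"
    unfolding pt_def add.assoc orthonormal_expansion[OF orthonormal, of "W - mid", symmetric] by simp
qed

lemma norm_pt_diff: "(norm (pt x y - pt x' y'))\<^sup>2 = (x - x')\<^sup>2 + (y - y')\<^sup>2"
proof -
  have "pt x y - pt x' y' = (x - x') *\<^sub>R f + (y - y') *\<^sub>R g"
    by (simp add: pt_def algebra_simps)
  moreover have "g \<bullet> f = 0" using orthonormal by (simp add: inner_commute)
  ultimately show ?thesis unfolding power2_norm_eq_inner
    using orthonormal by (simp add: inner_left_distrib inner_right_distrib power2_eq_square)
qed

lemma pt_eq_iff: "pt x y = pt x' y' \<longleftrightarrow> x = x' \<and> y = y'"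
proof -
  have "pt x y = pt x' y' \<longleftrightarrow> (norm (pt x y - pt x' y'))\<^sup>2 = 0" by simp
  then show ?thesis unfolding norm_pt_diff by (simp add: sum_power2_eq_zero_iff)
qed

lemma dist_pt_less:
  "(x - x')\<^sup>2 + (y - y')\<^sup>2 < (a - x')\<^sup>2 + (b - y')\<^sup>2 \<Longrightarrow> dist (pt x y) (pt x' y') < dist (pt a b) (pt x' y')"
  unfolding norm_pt_diff[symmetric] dist_norm by (rule power2_less_imp_less) auto

lemma pt_in_sphere:
  assumes "a \<ge> 0"
  shows "pt x y \<in> sphere (pt x' y') a \<longleftrightarrow> (x - x')\<^sup>2 + (y - y')\<^sup>2 = a\<^sup>2"
proof -
  have "pt x y \<in> sphere (pt x' y') a \<longleftrightarrow> (norm (pt x y - pt x' y'))\<^sup>2 = a\<^sup>2"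
    using assms by (simp add: dist_norm norm_minus_commute)
  then show ?thesis unfolding norm_pt_diff .
qed

lemma objective_pt:
  "objective Z1 Z2 Z3 d d d3 (pt x y) =
     2 * max \<bar>x\<^sup>2 + y\<^sup>2 + r\<^sup>2 / 4 - d\<^sup>2\<bar> (r * \<bar>x\<bar>) + \<bar>x\<^sup>2 + (y - s)\<^sup>2 - d3\<^sup>2\<bar>"
proof -
  define u where "u = x\<^sup>2 + y\<^sup>2 + r\<^sup>2 / 4 - d\<^sup>2"
  have "(x - - (r / 2))\<^sup>2 + (y - 0)\<^sup>2 - d\<^sup>2 = u + r * x" "(x - r / 2)\<^sup>2 + (y - 0)\<^sup>2 - d\<^sup>2 = u - r * x"
    by (simp_all add: u_def power2_eq_square field_simps)
  then show ?thesis
    unfolding objective_def norm_pt_diff u_def[symmetric]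
    using abs_add_abs_diff[of u "r * x"] r_pos by (simp add: abs_mult)
qed

text \<open>\<open>l\<close> is the common multiplier of the two base circles and \<open>m\<close> that of the apex circle.\<close>

lemma minimizers_axis:
  assumes "\<bar>l\<bar> \<le> 1" "\<bar>m\<bar> \<le> 1" "0 < 2 * l + m" "2 * l * y0 = m * (s - y0)"
    and l: "l * (y0\<^sup>2 + r\<^sup>2 / 4 - d\<^sup>2) = \<bar>y0\<^sup>2 + r\<^sup>2 / 4 - d\<^sup>2\<bar>"
    and m: "m * ((y0 - s)\<^sup>2 - d3\<^sup>2) = \<bar>(y0 - s)\<^sup>2 - d3\<^sup>2\<bar>"
  shows "minimizers Z1 Z2 Z3 d d d3 = {pt 0 y0}"
proof -
  let ?obj = "objective Z1 Z2 Z3 d d d3"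
  have bound: "k * t \<le> \<bar>t\<bar>" if "\<bar>k\<bar> \<le> 1" for k t :: real
    using mult_right_mono[OF that, of "\<bar>t\<bar>"] abs_ge_self[of "k * t"] by (simp add: abs_mult)
  have lower: "?obj (pt 0 y0) + (2 * l + m) * (x\<^sup>2 + (y - y0)\<^sup>2) \<le> ?obj (pt x y)" for x y
  proof -
    have "?obj (pt 0 y0) = 2 * (l * (y0\<^sup>2 + r\<^sup>2 / 4 - d\<^sup>2)) + m * ((y0 - s)\<^sup>2 - d3\<^sup>2)"
      unfolding l m by (simp add: objective_pt)
    \<comment> \<open>The combination has leading part (2l + m)(x^2 + y^2). The balance condition
      \<open>2 * l * y0 = m * (s - y0)\<close> makes its gradient vanish at (0, y0), so it equals
      its value there plus a multiple of the squared distance.\<close>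
    moreover have "2 * (l * (y0\<^sup>2 + r\<^sup>2 / 4 - d\<^sup>2)) + m * ((y0 - s)\<^sup>2 - d3\<^sup>2) + (2 * l + m) * (x\<^sup>2 + (y - y0)\<^sup>2)
      = 2 * (l * (x\<^sup>2 + y\<^sup>2 + r\<^sup>2 / 4 - d\<^sup>2)) + m * (x\<^sup>2 + (y - s)\<^sup>2 - d3\<^sup>2)"
      using assms(4) by algebra
    moreover note bound[OF assms(1), of "x\<^sup>2 + y\<^sup>2 + r\<^sup>2 / 4 - d\<^sup>2"]
      bound[OF assms(2), of "x\<^sup>2 + (y - s)\<^sup>2 - d3\<^sup>2"]
      max.cobounded1[of "\<bar>x\<^sup>2 + y\<^sup>2 + r\<^sup>2 / 4 - d\<^sup>2\<bar>" "r * \<bar>x\<bar>"]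
    ultimately show ?thesis
      unfolding objective_pt[of d d3 x y] by linarith
  qed
  have sq: "0 \<le> (2 * l + m) * (x\<^sup>2 + (y - y0)\<^sup>2)" for x y
    using assms(3) by simp
  have "?obj (pt 0 y0) \<le> ?obj V" for V
  proof -
    obtain x y where "V = pt x y" by (rule pt_surj)
    then show ?thesis using lower[of x y] sq[of x y] by simp
  qed
  moreover have "?obj V \<le> ?obj (pt 0 y0) \<longleftrightarrow> V = pt 0 y0" for V
  proof
    obtain x y where V: "V = pt x y" by (rule pt_surj)
    assume "?obj V \<le> ?obj (pt 0 y0)"
    then have "(2 * l + m) * (x\<^sup>2 + (y - y0)\<^sup>2) \<le> 0" using lower[of x y] V by simp
    then have "x\<^sup>2 + (y - y0)\<^sup>2 \<le> 0" using assms(3) by (simp add: mult_le_0_iff)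
    then show "V = pt 0 y0" by (simp add: V pt_eq_iff sum_power2_le_zero_iff)
  qed simp
  ultimately show ?thesis using minimizers_eq_sublevel[of "?obj (pt 0 y0)" Z1 Z2 Z3 d d d3 "pt 0 y0"] by auto
qed

lemma minimizers_N3:
  assumes "2 * s / 3 \<le> d3" "d3 \<le> 2 * s" "d\<^sup>2 \<le> r\<^sup>2 / 4 + (s - d3)\<^sup>2"
  shows "minimizers Z1 Z2 Z3 d d d3 = {pt 0 (s - d3)}"
\<comment> \<open>For y0 = s - d3 the apex term vanishes, so its multiplier is free in [-1, 1] and
  the balance condition determines it. The bound 1 on its modulus is exactly 2s/3 <= d3 <=
  2s.\<close>
proof (rule minimizers_axis[of 1 "2 * (s - d3) / d3"])
  have "0 < d3" using assms(1) s_pos by linarith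
  then show "\<bar>2 * (s - d3) / d3\<bar> \<le> 1" "0 < 2 * 1 + 2 * (s - d3) / d3"
    "2 * 1 * (s - d3) = 2 * (s - d3) / d3 * (s - (s - d3))"
    using assms(1,2) s_pos by (auto simp: abs_le_iff field_simps)
qed (use assms(3) in auto)

end

text \<open>Here \<open>h\<close> is a parameter tied to \<open>d\<close> by its defining equation,
  and h > 0 means that the base circles cross in two points. The third radius is a parameter as
  well, so that it can be varied when the threshold \<open>d3_star\<close> is computed.\<close>

locale isosceles_circles = isosceles_frame +
  fixes d d3 h :: real
  assumes d_pos: "d > 0" and d3_pos: "d3 > 0" and h_pos: "h > 0"
    and d_sq: "d\<^sup>2 = h\<^sup>2 + r\<^sup>2 / 4"
begin

text \<open>The points \<open>S23+\<close>, \<open>S31+\<close>, \<open>S23-\<close>, \<open>S31-\<close> have abscissae \<open>- xp\<close>, \<open>xp\<close>, \<open>xm\<close>, \<open>- xm\<close>;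
  in particular the near points lie on the opposite side of the axis.\<close>

definition c :: real where "c = h\<^sup>2 + s\<^sup>2 - d3\<^sup>2"
definition xp :: real where
  "xp = pos_root (4 * s\<^sup>2 + r\<^sup>2) (- (r * (c - 2 * s\<^sup>2))) (4 * s\<^sup>2 * h\<^sup>2 - c\<^sup>2)"
definition xm :: real where
  "xm = pos_root (4 * s\<^sup>2 + r\<^sup>2) (r * (c - 2 * s\<^sup>2)) (4 * s\<^sup>2 * h\<^sup>2 - c\<^sup>2)"

text \<open>At S12+ and S12- the function v takes the values c - 2hs and c + 2hs. Hence |c| < 2hs
  says that S12+ lies inside the apex circle and S12- outside, so each lateral circle crosses the
  apex circle once on either side of the axis. This is why the two roots have opposite
  signs.\<close>

lemma abs_c_sq: "\<bar>c\<bar> \<le> 2 * h * s \<longleftrightarrow> 0 \<le> 4 * s\<^sup>2 * h\<^sup>2 - c\<^sup>2" "\<bar>c\<bar> < 2 * h * s \<longleftrightarrow> 0 < 4 * s\<^sup>2 * h\<^sup>2 - c\<^sup>2"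
proof -
  have "\<bar>2 * h * s\<bar> = 2 * h * s" "(2 * h * s)\<^sup>2 = 4 * s\<^sup>2 * h\<^sup>2"
    using h_pos s_pos by (auto simp: power_mult_distrib)
  then show "\<bar>c\<bar> \<le> 2 * h * s \<longleftrightarrow> 0 \<le> 4 * s\<^sup>2 * h\<^sup>2 - c\<^sup>2" "\<bar>c\<bar> < 2 * h * s \<longleftrightarrow> 0 < 4 * s\<^sup>2 * h\<^sup>2 - c\<^sup>2"
    using abs_le_square_iff[of c "2 * h * s"] abs_le_square_iff[of "2 * h * s" c] by auto
qed

lemma lead_pos: "4 * s\<^sup>2 + r\<^sup>2 > 0"
  using r_pos by (simp add: add_nonneg_pos)

lemma
  assumes "\<bar>c\<bar> \<le> 2 * h * s"
  shows xp_nonneg: "0 \<le> xp" and xm_nonneg: "0 \<le> xm"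
    and xm_xp_factor: "(4 * s\<^sup>2 + r\<^sup>2) * x\<^sup>2 + 2 * (r * (c - 2 * s\<^sup>2)) * x - (4 * s\<^sup>2 * h\<^sup>2 - c\<^sup>2)
      = (4 * s\<^sup>2 + r\<^sup>2) * (x - xm) * (x + xp)"
  using pos_root_nonneg pos_root_quadratic lead_pos assms unfolding abs_c_sq xp_def xm_def by blast+

lemma S12_iff: "pt x y \<in> sphere Z1 d \<inter> sphere Z2 d \<longleftrightarrow> x = 0 \<and> (y = h \<or> y = - h)"
proof -
  have "pt x y \<in> sphere Z1 d \<inter> sphere Z2 d \<longleftrightarrow>
      (x + r / 2)\<^sup>2 + y\<^sup>2 = h\<^sup>2 + r\<^sup>2 / 4 \<and> (x - r / 2)\<^sup>2 + y\<^sup>2 = h\<^sup>2 + r\<^sup>2 / 4"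
    using d_pos by (simp add: pt_in_sphere d_sq del: mem_sphere)
  also have "\<dots> \<longleftrightarrow> x\<^sup>2 + y\<^sup>2 - h\<^sup>2 + r * x = 0 \<and> x\<^sup>2 + y\<^sup>2 - h\<^sup>2 - r * x = 0"
  proof -
    have "x\<^sup>2 + y\<^sup>2 - h\<^sup>2 + r * x = (x + r / 2)\<^sup>2 + y\<^sup>2 - (h\<^sup>2 + r\<^sup>2 / 4)"
      "x\<^sup>2 + y\<^sup>2 - h\<^sup>2 - r * x = (x - r / 2)\<^sup>2 + y\<^sup>2 - (h\<^sup>2 + r\<^sup>2 / 4)"
      by (simp_all add: power2_eq_square field_simps)
    then show ?thesis by linarith
  qed
  also have "\<dots> \<longleftrightarrow> r * x = 0 \<and> x\<^sup>2 + y\<^sup>2 - h\<^sup>2 = 0" by (smt (verit))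
  also have "\<dots> \<longleftrightarrow> x = 0 \<and> (y = h \<or> y = - h)" using r_pos by (auto simp: power2_eq_iff)
  finally show ?thesis .
qed

lemma near_S12: "near_point Z1 d Z2 d Z3 = pt 0 h"
  and far_S12: "far_point Z1 d Z2 d Z3 = pt 0 (- h)"
proof -
  have less: "dist (pt 0 h) Z3 < dist (pt 0 (- h)) Z3"
    using h_pos s_pos by (intro dist_pt_less) (simp add: power2_eq_square algebra_simps)
  have mem: "V = pt 0 h \<or> V = pt 0 (- h)" if "V \<in> sphere Z1 d \<inter> sphere Z2 d" for V
    using that by (cases rule: pt_surj[of V]) (simp only: S12_iff, auto)
  show "near_point Z1 d Z2 d Z3 = pt 0 h" "far_point Z1 d Z2 d Z3 = pt 0 (- h)"
    using less mem S12_iff by (blast intro!: near_pointI far_pointI)+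
qed

text \<open>Since |W - Z2|^2 - d^2 = u - r x, the first equation is the circle around Z2.
  Subtracting the circle equations leaves the radical axis y = (c + r x)/(2s), and substituting it
  back gives the quadratic with roots \<open>xm\<close> and \<open>- xp\<close>.\<close>

lemma S23_iff:
  assumes "\<bar>c\<bar> \<le> 2 * h * s"
  shows "x\<^sup>2 + y\<^sup>2 - h\<^sup>2 = r * x \<and> x\<^sup>2 + (y - s)\<^sup>2 = d3\<^sup>2 \<longleftrightarrow>
    (x = xm \<or> x = - xp) \<and> y = (c + r * x) / (2 * s)"
proof -
  have "x\<^sup>2 + y\<^sup>2 - h\<^sup>2 = r * x \<and> x\<^sup>2 + (y - s)\<^sup>2 = d3\<^sup>2 \<longleftrightarrow>
     x\<^sup>2 + y\<^sup>2 - h\<^sup>2 = r * x \<and> y = (c + r * x) / (2 * s)"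
    using s_pos by (auto simp: c_def field_simps power2_eq_square)
  also have "\<dots> \<longleftrightarrow> 4 * s\<^sup>2 * (x\<^sup>2 - h\<^sup>2 - r * x) + (c + r * x)\<^sup>2 = 0 \<and> y = (c + r * x) / (2 * s)"
  proof -
    have "4 * s\<^sup>2 * (x\<^sup>2 - h\<^sup>2 - r * x) + (c + r * x)\<^sup>2 = 4 * s\<^sup>2 * (x\<^sup>2 + y\<^sup>2 - h\<^sup>2 - r * x)"
      if "y = (c + r * x) / (2 * s)"
      using s_pos by (simp add: that field_simps power2_eq_square)
    then show ?thesis using s_pos by auto
  qed
  also have "4 * s\<^sup>2 * (x\<^sup>2 - h\<^sup>2 - r * x) + (c + r * x)\<^sup>2
      = (4 * s\<^sup>2 + r\<^sup>2) * x\<^sup>2 + 2 * (r * (c - 2 * s\<^sup>2)) * x - (4 * s\<^sup>2 * h\<^sup>2 - c\<^sup>2)"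
    by (simp add: algebra_simps power2_eq_square)
  also have "\<dots> = (4 * s\<^sup>2 + r\<^sup>2) * (x - xm) * (x + xp)" by (rule xm_xp_factor[OF assms])
  finally show ?thesis using lead_pos by (auto simp: add_eq_0_iff)
qed

lemma in_S23_iff:
  assumes "\<bar>c\<bar> \<le> 2 * h * s"
  shows "pt x y \<in> sphere Z2 d \<inter> sphere Z3 d3 \<longleftrightarrow> (x = xm \<or> x = - xp) \<and> y = (c + r * x) / (2 * s)"
  unfolding S23_iff[OF assms, symmetric] Int_iff
  using d_pos d3_pos by (simp add: pt_in_sphere d_sq del: mem_sphere) (auto simp: power2_eq_square field_simps)

lemma in_S31_iff:
  assumes "\<bar>c\<bar> \<le> 2 * h * s"
  shows "pt x y \<in> sphere Z3 d3 \<inter> sphere Z1 d \<longleftrightarrow> (x = - xm \<or> x = xp) \<and> y = (c - r * x) / (2 * s)"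
proof -
  \<comment> \<open>Reflection in the axis of the triangle exchanges the circles around Z1 and
    Z2.\<close>
  have "pt x y \<in> sphere Z3 d3 \<inter> sphere Z1 d \<longleftrightarrow> pt (- x) y \<in> sphere Z2 d \<inter> sphere Z3 d3"
    using d_pos d3_pos by (simp add: pt_in_sphere del: mem_sphere) (auto simp: power2_eq_square field_simps)
  then show ?thesis unfolding in_S23_iff[OF assms] by auto
qed

text \<open>On the circle around Z2 the squared distance to Z1 is d^2 + 2 r x, so nearness is
  decided by the abscissa alone; S31 follows by symmetry. If both roots are 0, the two points
  coincide and are near and far point at once.\<close>

lemma
  assumes c: "\<bar>c\<bar> \<le> 2 * h * s"
  shows near_S23: "near_point Z2 d Z3 d3 Z1 = pt (- xp) ((c - r * xp) / (2 * s))"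
    and far_S23: "far_point Z2 d Z3 d3 Z1 = pt xm ((c + r * xm) / (2 * s))"
    and near_S31: "near_point Z3 d3 Z1 d Z2 = pt xp ((c - r * xp) / (2 * s))"
    and far_S31: "far_point Z3 d3 Z1 d Z2 = pt (- xm) ((c + r * xm) / (2 * s))"
proof -
  define yp ym where "yp = (c - r * xp) / (2 * s)" and "ym = (c + r * xm) / (2 * s)"
  note xs = xp_nonneg[OF c] xm_nonneg[OF c]
  have less: "xp = 0 \<and> xm = 0 \<or> dist (pt (- xp) yp) Z1 < dist (pt xm ym) Z1"
    "xp = 0 \<and> xm = 0 \<or> dist (pt xp yp) Z2 < dist (pt (- xm) ym) Z2"
  proof -
    have "xm\<^sup>2 + ym\<^sup>2 - h\<^sup>2 = r * xm" "xp\<^sup>2 + yp\<^sup>2 - h\<^sup>2 = - (r * xp)"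
      using S23_iff[OF c, of xm ym] S23_iff[OF c, of "- xp" yp] by (auto simp: yp_def ym_def)
    then have *: "(- xp - - (r / 2))\<^sup>2 + (yp - 0)\<^sup>2 = h\<^sup>2 + r\<^sup>2 / 4 - 2 * (r * xp)"
      "(xm - - (r / 2))\<^sup>2 + (ym - 0)\<^sup>2 = h\<^sup>2 + r\<^sup>2 / 4 + 2 * (r * xm)"
      "(xp - r / 2)\<^sup>2 + (yp - 0)\<^sup>2 = h\<^sup>2 + r\<^sup>2 / 4 - 2 * (r * xp)"
      "(- xm - r / 2)\<^sup>2 + (ym - 0)\<^sup>2 = h\<^sup>2 + r\<^sup>2 / 4 + 2 * (r * xm)"
      by (simp_all add: power2_eq_square field_simps)
    have "0 < r * (xp + xm)" if "\<not> (xp = 0 \<and> xm = 0)"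
      using that xs r_pos by (intro mult_pos_pos) auto
    then have "h\<^sup>2 + r\<^sup>2 / 4 - 2 * (r * xp) < h\<^sup>2 + r\<^sup>2 / 4 + 2 * (r * xm)" if "\<not> (xp = 0 \<and> xm = 0)"
      using that by (simp add: distrib_left)
    with * show "xp = 0 \<and> xm = 0 \<or> dist (pt (- xp) yp) Z1 < dist (pt xm ym) Z1"
      "xp = 0 \<and> xm = 0 \<or> dist (pt xp yp) Z2 < dist (pt (- xm) ym) Z2"
      using dist_pt_less by metis+
  qed
  have S23: "V \<in> sphere Z2 d \<inter> sphere Z3 d3 \<longleftrightarrow> V = pt (- xp) yp \<or> V = pt xm ym" for V
    by (rule pt_surj[of V]) (auto simp: in_S23_iff[OF c] pt_eq_iff yp_def ym_def simp del: Int_iff)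
  have S31: "V \<in> sphere Z3 d3 \<inter> sphere Z1 d \<longleftrightarrow> V = pt xp yp \<or> V = pt (- xm) ym" for V
    by (rule pt_surj[of V]) (auto simp: in_S31_iff[OF c] pt_eq_iff yp_def ym_def simp del: Int_iff)
  have eq: "pt (- xp) yp = pt xm ym" "pt xp yp = pt (- xm) ym" if "xp = 0" "xm = 0"
    using that by (simp_all add: yp_def ym_def)
  have "near_point Z2 d Z3 d3 Z1 = pt (- xp) yp"
    by (rule near_pointI) (use less(1) S23 eq(1) in metis)+
  moreover have "far_point Z2 d Z3 d3 Z1 = pt xm ym"
    by (rule far_pointI) (use less(1) S23 eq(1) in metis)+
  moreover have "near_point Z3 d3 Z1 d Z2 = pt xp yp"
    by (rule near_pointI) (use less(2) S31 eq(2) in metis)+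
  moreover have "far_point Z3 d3 Z1 d Z2 = pt (- xm) ym"
    by (rule far_pointI) (use less(2) S31 eq(2) in metis)+
  ultimately show "near_point Z2 d Z3 d3 Z1 = pt (- xp) ((c - r * xp) / (2 * s))"
    "far_point Z2 d Z3 d3 Z1 = pt xm ((c + r * xm) / (2 * s))"
    "near_point Z3 d3 Z1 d Z2 = pt xp ((c - r * xp) / (2 * s))"
    "far_point Z3 d3 Z1 d Z2 = pt (- xm) ((c + r * xm) / (2 * s))"
    by (simp_all add: yp_def ym_def)
qed

text \<open>The numerators of the critical values of \<open>c\<close>: up to positive factors, \<open>S12+\<close> ties with the
  pair \<open>S23+\<close>, \<open>S31+\<close> at \<open>c = K\<close>, \<open>S12-\<close> at \<open>c = - K\<close>, and \<open>S12+\<close> ties with \<open>S23-\<close>, \<open>S31-\<close> at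
  \<open>c = L\<close>. So \<open>K\<close> encodes the thresholds \<open>R\<close>, \<open>M\<close> and \<open>T\<close>, and \<open>L\<close> encodes \<open>d3*\<close> and \<open>P\<close>.\<close>

definition K :: real where "K = 2 * h * s * (4 * s\<^sup>2 - 3 * r\<^sup>2) + 8 * r\<^sup>2 * s\<^sup>2"
definition L :: real where "L = 2 * h * s * (4 * s\<^sup>2 - 3 * r\<^sup>2) - 8 * r\<^sup>2 * s\<^sup>2"

abbreviation "X \<equiv> minimizers Z1 Z2 Z3 d d d3"
abbreviation "S12p \<equiv> near_point Z1 d Z2 d Z3"
abbreviation "S12m \<equiv> far_point Z1 d Z2 d Z3"
abbreviation "S23p \<equiv> near_point Z2 d Z3 d3 Z1"
abbreviation "S23m \<equiv> far_point Z2 d Z3 d3 Z1"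
abbreviation "S31p \<equiv> near_point Z3 d3 Z1 d Z2"
abbreviation "S31m \<equiv> far_point Z3 d3 Z1 d Z2"
abbreviation "obj \<equiv> objective Z1 Z2 Z3 d d d3"

lemma obj_pt: "obj (pt x y) = 2 * max \<bar>x\<^sup>2 + y\<^sup>2 - h\<^sup>2\<bar> (r * \<bar>x\<bar>) + \<bar>x\<^sup>2 + y\<^sup>2 - h\<^sup>2 + c - 2 * s * y\<bar>"
proof -
  have "x\<^sup>2 + y\<^sup>2 + r\<^sup>2 / 4 - d\<^sup>2 = x\<^sup>2 + y\<^sup>2 - h\<^sup>2" by (simp add: d_sq)
  moreover have "x\<^sup>2 + (y - s)\<^sup>2 - d3\<^sup>2 = x\<^sup>2 + y\<^sup>2 - h\<^sup>2 + c - 2 * s * y"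
    by (simp add: c_def power2_diff)
  ultimately show ?thesis by (simp only: objective_pt)
qed

lemma obj_S12p: "obj S12p = \<bar>2 * h * s - c\<bar>"
  unfolding near_S12 obj_pt by (simp add: abs_minus_commute mult_ac)

lemma obj_S12m: "obj S12m = \<bar>2 * h * s + c\<bar>"
  unfolding far_S12 obj_pt by (simp add: algebra_simps)

lemma obj_S23_coords:
  assumes "x\<^sup>2 + y\<^sup>2 - h\<^sup>2 = r * x" "x\<^sup>2 + (y - s)\<^sup>2 = d3\<^sup>2"
  shows "obj (pt x y) = 2 * r * \<bar>x\<bar>" "obj (pt (- x) y) = 2 * r * \<bar>x\<bar>"
proof -
  have "x\<^sup>2 + y\<^sup>2 - h\<^sup>2 + c - 2 * s * y = 0"
    unfolding c_def using assms by algebra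
  moreover have "\<bar>x\<^sup>2 + y\<^sup>2 - h\<^sup>2\<bar> = r * \<bar>x\<bar>" using assms r_pos by (simp add: abs_mult)
  ultimately show "obj (pt x y) = 2 * r * \<bar>x\<bar>" "obj (pt (- x) y) = 2 * r * \<bar>x\<bar>"
    by (simp_all add: obj_pt)
qed

lemma
  assumes c: "\<bar>c\<bar> \<le> 2 * h * s"
  shows obj_S23p: "obj S23p = 2 * r * xp" and obj_S31p: "obj S31p = 2 * r * xp"
    and obj_S23m: "obj S23m = 2 * r * xm" and obj_S31m: "obj S31m = 2 * r * xm"
proof -
  have "(- xp)\<^sup>2 + ((c - r * xp) / (2 * s))\<^sup>2 - h\<^sup>2 = r * - xp \<and> (- xp)\<^sup>2 + ((c - r * xp) / (2 * s) - s)\<^sup>2 = d3\<^sup>2"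
    "xm\<^sup>2 + ((c + r * xm) / (2 * s))\<^sup>2 - h\<^sup>2 = r * xm \<and> xm\<^sup>2 + ((c + r * xm) / (2 * s) - s)\<^sup>2 = d3\<^sup>2"
    unfolding S23_iff[OF c] by simp_all
  then show "obj S23p = 2 * r * xp" "obj S31p = 2 * r * xp" "obj S23m = 2 * r * xm" "obj S31m = 2 * r * xm"
    unfolding near_S23[OF c] far_S23[OF c] near_S31[OF c] far_S31[OF c]
    using obj_S23_coords[of "- xp"] obj_S23_coords[of xm] xp_nonneg[OF c] xm_nonneg[OF c] by auto
qed

lemma obj_lower_bound:
  assumes c: "\<bar>c\<bar> < 2 * h * s" and m: "0 < m"
    and le: "m \<le> 2 * h * s - c" "m \<le> 2 * h * s + c" "m \<le> 2 * r * xp" "m \<le> 2 * r * xm"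
  shows "m \<le> obj W" and "obj W \<le> m \<Longrightarrow> W \<in> {S12p, S12m, S23p, S31p, S23m, S31m}"
proof -
  obtain x y where W: "W = pt x y" by (rule pt_surj)
  define u v where "u = x\<^sup>2 + y\<^sup>2 - h\<^sup>2" and "v = u + c - 2 * s * y"
  have obj: "obj W = 2 * max \<bar>u\<bar> (r * \<bar>x\<bar>) + \<bar>v\<bar>"
    unfolding W obj_pt u_def v_def ..
  then have obj_u: "2 * \<bar>u\<bar> + \<bar>v\<bar> \<le> obj W" and obj_x: "2 * r * \<bar>x\<bar> + \<bar>v\<bar> \<le> obj W" by simp_all
  have c': "\<bar>c\<bar> \<le> 2 * h * s" using c by simp
  \<comment> \<open>Up to the factor r^2 this is the quadratic of \<open>xm_xp_factor\<close> being
    nonpositive at t / r, that is, t / r lying between \<open>- xp\<close> and \<open>xm\<close>.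
    The bounds of m by 2 r xp and 2 r xm provide this for both signs of t.\<close>
  have q: "4 * s\<^sup>2 * t\<^sup>2 \<le> r\<^sup>2 * (4 * s\<^sup>2 * h\<^sup>2 + 4 * s\<^sup>2 * t - (c + t)\<^sup>2)" if "\<bar>t\<bar> = m / 2" for t
  proof -
    have neg: "(4 * s\<^sup>2 + r\<^sup>2) * (w - xm) * (w + xp) = - ((4 * s\<^sup>2 + r\<^sup>2) * ((xm - w) * (w + xp)))" for w
      by (simp add: algebra_simps)
    have "m / 2 / r \<le> xp" "m / 2 / r \<le> xm" "0 < m / 2 / r"
      using le m r_pos by (simp_all add: divide_le_eq mult_ac)
    moreover have "t / r = m / 2 / r \<or> t / r = - (m / 2 / r)"
      using that by (auto simp: abs_if split: if_splits)
    ultimately have "0 \<le> (xm - t / r) * (t / r + xp)" by (intro mult_nonneg_nonneg) auto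
    then have "0 \<le> (4 * s\<^sup>2 + r\<^sup>2) * ((xm - t / r) * (t / r + xp))" using lead_pos by (simp del: distrib_left)
    then have "(4 * s\<^sup>2 + r\<^sup>2) * (t / r)\<^sup>2 + 2 * (r * (c - 2 * s\<^sup>2)) * (t / r) - (4 * s\<^sup>2 * h\<^sup>2 - c\<^sup>2) \<le> 0"
      unfolding xm_xp_factor[OF c'] neg by simp
    then have "r\<^sup>2 * ((4 * s\<^sup>2 + r\<^sup>2) * (t / r)\<^sup>2 + 2 * (r * (c - 2 * s\<^sup>2)) * (t / r) - (4 * s\<^sup>2 * h\<^sup>2 - c\<^sup>2)) \<le> 0"
      by (simp add: mult_le_0_iff)
    moreover have "r\<^sup>2 * ((4 * s\<^sup>2 + r\<^sup>2) * (t / r)\<^sup>2 + 2 * (r * (c - 2 * s\<^sup>2)) * (t / r) - (4 * s\<^sup>2 * h\<^sup>2 - c\<^sup>2))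
      = 4 * s\<^sup>2 * t\<^sup>2 - r\<^sup>2 * (4 * s\<^sup>2 * h\<^sup>2 + 4 * s\<^sup>2 * t - (c + t)\<^sup>2)"
      using r_pos by (simp add: field_simps power2_eq_square)
    ultimately show ?thesis by simp
  qed
  note bound = rhombus_bound[OF r_pos s_pos m le(1,2) q, of x y, folded u_def, folded v_def]
  show ge: "m \<le> obj W"
    using bound(1) obj_u obj_x by linarith
  assume "obj W \<le> m"
  then have uv: "2 * \<bar>u\<bar> + \<bar>v\<bar> \<le> m" and xv: "2 * r * \<bar>x\<bar> + \<bar>v\<bar> = m"
    using obj_u obj_x bound(1) by linarith+
  then consider "v = 0" "\<bar>u\<bar> = m / 2" | "u = 0" "\<bar>v\<bar> = m"
    using bound(2) by auto
  then show "W \<in> {S12p, S12m, S23p, S31p, S23m, S31m}"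
  proof cases
    case 1
    have "\<bar>u\<bar> = r * \<bar>x\<bar>" using 1 xv by simp
    moreover have v: "x\<^sup>2 + (y - s)\<^sup>2 = d3\<^sup>2"
      using 1(1) unfolding v_def u_def c_def by algebra
    ultimately have "u = r * x \<or> u = r * - x" using r_pos by (auto simp: abs_if split: if_splits)
    then have "(x\<^sup>2 + y\<^sup>2 - h\<^sup>2 = r * x \<and> x\<^sup>2 + (y - s)\<^sup>2 = d3\<^sup>2) \<or>
      ((- x)\<^sup>2 + y\<^sup>2 - h\<^sup>2 = r * (- x) \<and> (- x)\<^sup>2 + (y - s)\<^sup>2 = d3\<^sup>2)"
      using v by (simp add: u_def)
    then show ?thesis
      unfolding S23_iff[OF c'] W near_S23[OF c'] far_S23[OF c'] near_S31[OF c'] far_S31[OF c']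
      by (auto simp: pt_eq_iff minus_equation_iff[of x])
  next
    case 2
    then have "x = 0" using xv r_pos by simp
    then have "y\<^sup>2 = h\<^sup>2" using 2 by (simp add: u_def)
    then show ?thesis using \<open>x = 0\<close> by (auto simp: W near_S12 far_S12 power2_eq_iff)
  qed
qed

text \<open>The number m is the least of the four candidate values. The conditional singletons let
  one equation cover every pattern of ties.\<close>

lemma X_eq:
  assumes c: "\<bar>c\<bar> < 2 * h * s"
    and le: "m \<le> 2 * h * s - c" "m \<le> 2 * h * s + c" "m \<le> 2 * r * xp" "m \<le> 2 * r * xm"
    and attained: "m = 2 * h * s - c \<or> m = 2 * h * s + c \<or> m = 2 * r * xp \<or> m = 2 * r * xm"
  shows "X = {W \<in> {S12p}. 2 * h * s - c = m} \<union> {W \<in> {S12m}. 2 * h * s + c = m} \<union>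
    {W \<in> {S23p, S31p}. 2 * r * xp = m} \<union> {W \<in> {S23m, S31m}. 2 * r * xm = m}"
proof -
  have c': "\<bar>c\<bar> \<le> 2 * h * s" using c by simp
  have "0 < 4 * s\<^sup>2 * h\<^sup>2 - c\<^sup>2" using c abs_c_sq(2) by simp
  then have "0 < xp" "0 < xm" unfolding xp_def xm_def using lead_pos pos_root_pos by blast+
  then have m: "0 < m" using attained c r_pos by auto
  have vals: "obj S12p = 2 * h * s - c" "obj S12m = 2 * h * s + c"
    "obj S23p = 2 * r * xp" "obj S31p = 2 * r * xp" "obj S23m = 2 * r * xm" "obj S31m = 2 * r * xm"
    using obj_S12p obj_S12m obj_S23p[OF c'] obj_S31p[OF c'] obj_S23m[OF c'] obj_S31m[OF c'] c by auto
  have eq: "obj W \<le> m \<longleftrightarrow> obj W = m" for W using obj_lower_bound(1)[OF c m le, of W] by linarith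
  obtain W where "obj W \<le> m" using vals attained by (metis order_refl)
  then have "X = {W. obj W = m}"
    using minimizers_eq_sublevel[of m Z1 Z2 Z3 d d d3 W] obj_lower_bound(1)[OF c m le] eq by auto
  also have "\<dots> = {W \<in> {S12p, S12m, S23p, S31p, S23m, S31m}. obj W = m}"
    using obj_lower_bound(2)[OF c m le] by auto
  also have "\<dots> = {W \<in> {S12p}. 2 * h * s - c = m} \<union> {W \<in> {S12m}. 2 * h * s + c = m} \<union>
    {W \<in> {S23p, S31p}. 2 * r * xp = m} \<union> {W \<in> {S23m, S31m}. 2 * r * xm = m}"
    using vals by auto
  finally show ?thesis .
qed

text \<open>The root compared with w/(2r), where w is one of 2hs - c and 2hs + c, leads to a
  quadratic in w with constant term minus the product of both. The factor w > 0 cancels, and what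
  remains is linear in w, the other factor and c, hence linear in c.\<close>

lemma
  assumes c: "\<bar>c\<bar> < 2 * h * s"
  shows xp_less_S12p: "2 * r * xp < 2 * h * s - c \<longleftrightarrow> c * (4 * s\<^sup>2 + 9 * r\<^sup>2) < K"
    and xp_eq_S12p: "2 * r * xp = 2 * h * s - c \<longleftrightarrow> c * (4 * s\<^sup>2 + 9 * r\<^sup>2) = K"
    and xp_less_S12m: "2 * r * xp < 2 * h * s + c \<longleftrightarrow> - c * (4 * s\<^sup>2 + r\<^sup>2) < K"
    and xp_eq_S12m: "2 * r * xp = 2 * h * s + c \<longleftrightarrow> - c * (4 * s\<^sup>2 + r\<^sup>2) = K"
    and xm_less_S12p: "2 * r * xm < 2 * h * s - c \<longleftrightarrow> c * (4 * s\<^sup>2 + r\<^sup>2) < L"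
    and xm_eq_S12p: "2 * r * xm = 2 * h * s - c \<longleftrightarrow> c * (4 * s\<^sup>2 + r\<^sup>2) = L"
    and xp_less_xm: "xp < xm \<longleftrightarrow> c < 2 * s\<^sup>2"
    and xp_eq_xm: "xp = xm \<longleftrightarrow> c = 2 * s\<^sup>2"
proof -
  have g: "0 < 4 * s\<^sup>2 * h\<^sup>2 - c\<^sup>2" using c abs_c_sq(2) by simp
  have scale: "2 * r * z < w \<longleftrightarrow> z < w / (2 * r)" "2 * r * z = w \<longleftrightarrow> z = w / (2 * r)" for z w :: real
    using r_pos by (auto simp: field_simps)
  define a b where "a = 2 * h * s - c" and "b = 2 * h * s + c"
  have ab: "0 < a" "0 < b" using c by (auto simp: a_def b_def)
  have abg: "4 * s\<^sup>2 * h\<^sup>2 - c\<^sup>2 = a * b" unfolding a_def b_def by (simp add: algebra_simps power2_eq_square)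
  have factor: "(4 * s\<^sup>2 + r\<^sup>2) * (w / (2 * r))\<^sup>2 + 2 * (r * t) * (w / (2 * r)) - w * w'
      = w / (4 * r\<^sup>2) * ((4 * s\<^sup>2 + r\<^sup>2) * w + 4 * r\<^sup>2 * (t - w'))" for w w' t :: real
    using r_pos by (simp add: field_simps power2_eq_square)
  have pos: "0 < w / (4 * r\<^sup>2) * z \<longleftrightarrow> 0 < z" "w / (4 * r\<^sup>2) * z = 0 \<longleftrightarrow> z = 0" if "0 < w" for w z :: real
    using that r_pos by (auto simp: zero_less_mult_iff zero_less_divide_iff)
  have p: "xp < w / (2 * r) \<longleftrightarrow> 0 < (4 * s\<^sup>2 + r\<^sup>2) * w + 4 * r\<^sup>2 * (2 * s\<^sup>2 - c - w')"
    "xp = w / (2 * r) \<longleftrightarrow> (4 * s\<^sup>2 + r\<^sup>2) * w + 4 * r\<^sup>2 * (2 * s\<^sup>2 - c - w') = 0"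
    "xm < w / (2 * r) \<longleftrightarrow> 0 < (4 * s\<^sup>2 + r\<^sup>2) * w + 4 * r\<^sup>2 * (c - 2 * s\<^sup>2 - w')"
    "xm = w / (2 * r) \<longleftrightarrow> (4 * s\<^sup>2 + r\<^sup>2) * w + 4 * r\<^sup>2 * (c - 2 * s\<^sup>2 - w') = 0"
    if "0 < w" "4 * s\<^sup>2 * h\<^sup>2 - c\<^sup>2 = w * w'" for w w'
  proof -
    have w: "0 < w / (2 * r)" using that r_pos by simp
    have xs: "xp = pos_root (4 * s\<^sup>2 + r\<^sup>2) (r * (2 * s\<^sup>2 - c)) (w * w')"
      "xm = pos_root (4 * s\<^sup>2 + r\<^sup>2) (r * (c - 2 * s\<^sup>2)) (w * w')"
      unfolding xp_def xm_def that(2) by (simp_all add: algebra_simps)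
    show "xp < w / (2 * r) \<longleftrightarrow> 0 < (4 * s\<^sup>2 + r\<^sup>2) * w + 4 * r\<^sup>2 * (2 * s\<^sup>2 - c - w')"
      "xp = w / (2 * r) \<longleftrightarrow> (4 * s\<^sup>2 + r\<^sup>2) * w + 4 * r\<^sup>2 * (2 * s\<^sup>2 - c - w') = 0"
      "xm < w / (2 * r) \<longleftrightarrow> 0 < (4 * s\<^sup>2 + r\<^sup>2) * w + 4 * r\<^sup>2 * (c - 2 * s\<^sup>2 - w')"
      "xm = w / (2 * r) \<longleftrightarrow> (4 * s\<^sup>2 + r\<^sup>2) * w + 4 * r\<^sup>2 * (c - 2 * s\<^sup>2 - w') = 0"
      unfolding xs pos_root_compare[OF lead_pos g[unfolded that(2)] w] factor pos[OF that(1)] by (rule refl)+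
  qed
  have expand: "(4 * s\<^sup>2 + r\<^sup>2) * a + 4 * r\<^sup>2 * (2 * s\<^sup>2 - c - b) = K - c * (4 * s\<^sup>2 + 9 * r\<^sup>2)"
    "(4 * s\<^sup>2 + r\<^sup>2) * b + 4 * r\<^sup>2 * (2 * s\<^sup>2 - c - a) = K - - c * (4 * s\<^sup>2 + r\<^sup>2)"
    "(4 * s\<^sup>2 + r\<^sup>2) * a + 4 * r\<^sup>2 * (c - 2 * s\<^sup>2 - b) = L - c * (4 * s\<^sup>2 + r\<^sup>2)"
    unfolding a_def b_def K_def L_def by (simp_all add: algebra_simps power2_eq_square)
  show "2 * r * xp < 2 * h * s - c \<longleftrightarrow> c * (4 * s\<^sup>2 + 9 * r\<^sup>2) < K"
    "2 * r * xp = 2 * h * s - c \<longleftrightarrow> c * (4 * s\<^sup>2 + 9 * r\<^sup>2) = K"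
    "2 * r * xp < 2 * h * s + c \<longleftrightarrow> - c * (4 * s\<^sup>2 + r\<^sup>2) < K"
    "2 * r * xp = 2 * h * s + c \<longleftrightarrow> - c * (4 * s\<^sup>2 + r\<^sup>2) = K"
    "2 * r * xm < 2 * h * s - c \<longleftrightarrow> c * (4 * s\<^sup>2 + r\<^sup>2) < L"
    "2 * r * xm = 2 * h * s - c \<longleftrightarrow> c * (4 * s\<^sup>2 + r\<^sup>2) = L"
    unfolding scale a_def[symmetric] b_def[symmetric] p[OF ab(1) abg] p[OF ab(2) abg[unfolded mult.commute[of a]]] expand
    by linarith+
  have xm: "0 < xm" unfolding xm_def using g lead_pos pos_root_pos by blast
  have "(4 * s\<^sup>2 + r\<^sup>2) * xm\<^sup>2 + 2 * (r * (c - 2 * s\<^sup>2)) * xm - (4 * s\<^sup>2 * h\<^sup>2 - c\<^sup>2) = 0"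
    using xm_xp_factor[of xm] c by simp
  \<comment> \<open>To compare the two roots, the quadratic of \<open>xp\<close> is evaluated at
    \<open>xm\<close>. It differs from the quadratic of \<open>xm\<close> only in the sign of the
    linear term, so the value has the sign of 2 s^2 - c.\<close>
  then have root: "(4 * s\<^sup>2 + r\<^sup>2) * xm\<^sup>2 + 2 * - (r * (c - 2 * s\<^sup>2)) * xm - (4 * s\<^sup>2 * h\<^sup>2 - c\<^sup>2) = 4 * (r * xm) * (2 * s\<^sup>2 - c)"
    by (simp add: algebra_simps)
  have scale_iff: "0 < k * z \<longleftrightarrow> 0 < z" "k * z = 0 \<longleftrightarrow> z = 0" if "0 < k" for k z :: real
    using that by (auto simp: zero_less_mult_iff)
  have "0 < 4 * (r * xm)" using r_pos xm by simp
  with root show "xp < xm \<longleftrightarrow> c < 2 * s\<^sup>2" "xp = xm \<longleftrightarrow> c = 2 * s\<^sup>2"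
    unfolding xp_def pos_root_compare[OF lead_pos g xm] by (simp_all only: scale_iff) linarith+
qed

section \<open>Thresholds for the radii expressed through \<open>c\<close>, \<open>K\<close> and
  \<open>L\<close>\<close>

lemma thr_h: "thr_h r d = h"
  using h_pos by (simp add: thr_h_def d_sq)

lemma thr_R: "thr_R r s d = sqrt (h\<^sup>2 + s\<^sup>2 - K / (4 * s\<^sup>2 + 9 * r\<^sup>2))"
proof -
  define q where "q = 4 * s\<^sup>2 + 9 * r\<^sup>2"
  have q: "q \<noteq> 0" "4 * s\<^sup>2 + r\<^sup>2 = q - 8 * r\<^sup>2" using r_pos by (auto simp: q_def add_nonneg_eq_0_iff)
  show ?thesis unfolding thr_R_def thr_h K_def q_def[symmetric] q(2) using q(1) by (simp add: field_simps)
qed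

lemma thr_M: "thr_M r s d = sqrt (h\<^sup>2 + s\<^sup>2 - - K / (4 * s\<^sup>2 + r\<^sup>2))"
proof -
  define q where "q = 4 * s\<^sup>2 + r\<^sup>2"
  have q: "q \<noteq> 0" "4 * s\<^sup>2 + 9 * r\<^sup>2 = q + 8 * r\<^sup>2" using lead_pos by (auto simp: q_def)
  show ?thesis unfolding thr_M_def thr_h K_def q_def[symmetric] q(2) using q(1) by (simp add: field_simps)
qed

text \<open>Passing from d3 to c reverses order and turns thresholds under a root into linear
  conditions. In HOL \<open>sqrt\<close> is odd and strictly increasing on all reals, so the
  equivalences also hold where the radicand is negative.\<close>

lemma d3_sqrt: "d3 < sqrt (h\<^sup>2 + s\<^sup>2 - z) \<longleftrightarrow> z < c" "sqrt (h\<^sup>2 + s\<^sup>2 - z) < d3 \<longleftrightarrow> c < z"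
  "d3 = sqrt (h\<^sup>2 + s\<^sup>2 - z) \<longleftrightarrow> c = z"
proof -
  have e: "sqrt (h\<^sup>2 + s\<^sup>2 - c) = d3" using d3_pos by (simp add: c_def)
  note cmp = real_sqrt_less_iff[of "h\<^sup>2 + s\<^sup>2 - c" "h\<^sup>2 + s\<^sup>2 - z", unfolded e]
    real_sqrt_less_iff[of "h\<^sup>2 + s\<^sup>2 - z" "h\<^sup>2 + s\<^sup>2 - c", unfolded e]
    real_sqrt_eq_iff[of "h\<^sup>2 + s\<^sup>2 - c" "h\<^sup>2 + s\<^sup>2 - z", unfolded e]
  show "d3 < sqrt (h\<^sup>2 + s\<^sup>2 - z) \<longleftrightarrow> z < c" "sqrt (h\<^sup>2 + s\<^sup>2 - z) < d3 \<longleftrightarrow> c < z"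
    "d3 = sqrt (h\<^sup>2 + s\<^sup>2 - z) \<longleftrightarrow> c = z" unfolding cmp by auto
qed

lemma d3_R: "d3 < thr_R r s d \<longleftrightarrow> K < c * (4 * s\<^sup>2 + 9 * r\<^sup>2)"
  "thr_R r s d < d3 \<longleftrightarrow> c * (4 * s\<^sup>2 + 9 * r\<^sup>2) < K" "d3 = thr_R r s d \<longleftrightarrow> c * (4 * s\<^sup>2 + 9 * r\<^sup>2) = K"
proof -
  have "4 * s\<^sup>2 + 9 * r\<^sup>2 > 0" using r_pos by (simp add: add_nonneg_pos)
  then show "d3 < thr_R r s d \<longleftrightarrow> K < c * (4 * s\<^sup>2 + 9 * r\<^sup>2)"
  "thr_R r s d < d3 \<longleftrightarrow> c * (4 * s\<^sup>2 + 9 * r\<^sup>2) < K" "d3 = thr_R r s d \<longleftrightarrow> c * (4 * s\<^sup>2 + 9 * r\<^sup>2) = K"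
    unfolding thr_R d3_sqrt by (simp_all add: pos_divide_less_eq pos_less_divide_eq eq_divide_eq)
qed

lemma d3_M: "d3 < thr_M r s d \<longleftrightarrow> - c * (4 * s\<^sup>2 + r\<^sup>2) < K"
  "thr_M r s d < d3 \<longleftrightarrow> K < - c * (4 * s\<^sup>2 + r\<^sup>2)" "d3 = thr_M r s d \<longleftrightarrow> - c * (4 * s\<^sup>2 + r\<^sup>2) = K"
proof -
  show "d3 < thr_M r s d \<longleftrightarrow> - c * (4 * s\<^sup>2 + r\<^sup>2) < K"
  "thr_M r s d < d3 \<longleftrightarrow> K < - c * (4 * s\<^sup>2 + r\<^sup>2)" "d3 = thr_M r s d \<longleftrightarrow> - c * (4 * s\<^sup>2 + r\<^sup>2) = K"
    unfolding thr_M d3_sqrt pos_divide_less_eq[OF lead_pos] pos_less_divide_eq[OF lead_pos] eq_divide_eq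
    using lead_pos by auto
qed

lemma d_less_sqrt: "z \<ge> 0 \<Longrightarrow> d < sqrt (r\<^sup>2 / 4 + z\<^sup>2) \<longleftrightarrow> h < z" "z \<ge> 0 \<Longrightarrow> d = sqrt (r\<^sup>2 / 4 + z\<^sup>2) \<longleftrightarrow> h = z"
proof -
  assume z: "z \<ge> 0"
  have "d = sqrt (r\<^sup>2 / 4 + h\<^sup>2)" using d_pos d_sq by (simp add: real_sqrt_unique add.commute)
  then show "d < sqrt (r\<^sup>2 / 4 + z\<^sup>2) \<longleftrightarrow> h < z" "d = sqrt (r\<^sup>2 / 4 + z\<^sup>2) \<longleftrightarrow> h = z"
    using h_pos z power_strict_mono[of h z 2] power2_less_imp_less[of h z] by (auto simp: power2_eq_iff_nonneg)
qed

text \<open>K is linear in h, and T is the radius d whose h is its zero. There the ties of the near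
  pair with S12+ and with S12- meet at c = 0; for K < 0 the near pair is beaten at c = 0.\<close>

lemma d_T:
  assumes "4 * s\<^sup>2 < 3 * r\<^sup>2"
  shows "d < thr_T r s \<longleftrightarrow> 0 < K" "d = thr_T r s \<longleftrightarrow> K = 0" "thr_T r s < d \<longleftrightarrow> K < 0"
proof -
  let ?z = "s * (4 * r\<^sup>2 / (3 * r\<^sup>2 - 4 * s\<^sup>2))"
  have z: "?z \<ge> 0" "thr_T r s = sqrt (r\<^sup>2 / 4 + ?z\<^sup>2)"
    using assms s_pos by (simp, simp only: thr_T_def power_mult_distrib)
  have "K = 2 * s * (4 * r\<^sup>2 * s - h * (3 * r\<^sup>2 - 4 * s\<^sup>2))" by (simp add: K_def algebra_simps power2_eq_square)
  moreover have "h < ?z \<longleftrightarrow> 0 < 4 * r\<^sup>2 * s - h * (3 * r\<^sup>2 - 4 * s\<^sup>2)"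
    "h = ?z \<longleftrightarrow> 4 * r\<^sup>2 * s - h * (3 * r\<^sup>2 - 4 * s\<^sup>2) = 0"
    using assms by (auto simp: field_simps)
  ultimately show "d < thr_T r s \<longleftrightarrow> 0 < K" "d = thr_T r s \<longleftrightarrow> K = 0"
    unfolding z(2) d_less_sqrt[OF z(1)] using s_pos by (auto simp: zero_less_mult_iff)
  then show "thr_T r s < d \<longleftrightarrow> K < 0" by linarith
qed

text \<open>Again linear in h: P is the radius at which S12+ ties with the far pair exactly at c = 2
  s^2, the level where near and far pair have equal values.\<close>

lemma d_P:
  assumes "3 * r\<^sup>2 < 4 * s\<^sup>2"
  shows "d < thr_P r s \<longleftrightarrow> L < 2 * s\<^sup>2 * (4 * s\<^sup>2 + r\<^sup>2)" "d = thr_P r s \<longleftrightarrow> L = 2 * s\<^sup>2 * (4 * s\<^sup>2 + r\<^sup>2)"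
    "thr_P r s < d \<longleftrightarrow> 2 * s\<^sup>2 * (4 * s\<^sup>2 + r\<^sup>2) < L"
proof -
  let ?z = "s * ((4 * s\<^sup>2 + 5 * r\<^sup>2) / (4 * s\<^sup>2 - 3 * r\<^sup>2))"
  have z: "?z \<ge> 0" "thr_P r s = sqrt (r\<^sup>2 / 4 + ?z\<^sup>2)"
    using assms s_pos by (simp, simp only: thr_P_def power_mult_distrib)
  have eq: "2 * s\<^sup>2 * (4 * s\<^sup>2 + r\<^sup>2) - L = 2 * s * (s * (4 * s\<^sup>2 + 5 * r\<^sup>2) - h * (4 * s\<^sup>2 - 3 * r\<^sup>2))"
    by (simp add: L_def algebra_simps power2_eq_square)
  have "h < ?z \<longleftrightarrow> 0 < s * (4 * s\<^sup>2 + 5 * r\<^sup>2) - h * (4 * s\<^sup>2 - 3 * r\<^sup>2)"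
    "h = ?z \<longleftrightarrow> s * (4 * s\<^sup>2 + 5 * r\<^sup>2) - h * (4 * s\<^sup>2 - 3 * r\<^sup>2) = 0"
    using assms by (auto simp: field_simps)
  moreover have "0 < 2 * s * w \<longleftrightarrow> 0 < w" "2 * s * w = 0 \<longleftrightarrow> w = 0" for w
    using s_pos by (auto simp: zero_less_mult_iff)
  ultimately have "h < ?z \<longleftrightarrow> 0 < 2 * s\<^sup>2 * (4 * s\<^sup>2 + r\<^sup>2) - L" "h = ?z \<longleftrightarrow> 2 * s\<^sup>2 * (4 * s\<^sup>2 + r\<^sup>2) - L = 0"
    unfolding eq by blast+
  then show "d < thr_P r s \<longleftrightarrow> L < 2 * s\<^sup>2 * (4 * s\<^sup>2 + r\<^sup>2)" "d = thr_P r s \<longleftrightarrow> L = 2 * s\<^sup>2 * (4 * s\<^sup>2 + r\<^sup>2)"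
    unfolding z(2) d_less_sqrt[OF z(1)] by linarith+
  then show "thr_P r s < d \<longleftrightarrow> 2 * s\<^sup>2 * (4 * s\<^sup>2 + r\<^sup>2) < L" by linarith
qed

section \<open>Comparison of the candidate values\<close>

text \<open>For c <= 2 s^2 the far pair is no better than the near pair, so beating the near pair is
  enough; otherwise the comparison with the far pair is made through L. S12- loses because c >
  0.\<close>

lemma X_S12p:
  assumes "\<bar>c\<bar> < 2 * h * s" "0 < c" "K < c * (4 * s\<^sup>2 + 9 * r\<^sup>2)" "c \<le> 2 * s\<^sup>2 \<or> L < c * (4 * s\<^sup>2 + r\<^sup>2)"
  shows "X = {S12p}"
proof -
  have "2 * h * s - c < 2 * r * xp" using xp_less_S12p xp_eq_S12p assms(1,3) by linarith
  moreover have "2 * h * s - c < 2 * r * xm"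
  proof (cases "c \<le> 2 * s\<^sup>2")
    case True
    then have "xp \<le> xm" using xp_less_xm xp_eq_xm assms(1) by linarith
    then have "2 * r * xp \<le> 2 * r * xm" using r_pos by simp
    then show ?thesis using calculation by linarith
  next
    case False
    then show ?thesis using xm_less_S12p xm_eq_S12p assms(1,4) by linarith
  qed
  moreover have "2 * h * s - c < 2 * h * s + c" using assms by simp
  ultimately show ?thesis using X_eq[OF assms(1), of "2 * h * s - c"] by auto
qed

lemma X_outer:
  assumes c: "\<bar>c\<bar> < 2 * h * s" "c < 2 * s\<^sup>2"
    and le: "c * (4 * s\<^sup>2 + 9 * r\<^sup>2) \<le> K" "- c * (4 * s\<^sup>2 + r\<^sup>2) \<le> K"
  shows "X = {S23p, S31p} \<union> {W \<in> {S12p}. c * (4 * s\<^sup>2 + 9 * r\<^sup>2) = K} \<union> {W \<in> {S12m}. - c * (4 * s\<^sup>2 + r\<^sup>2) = K}"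
proof -
  have "xp < xm" using xp_less_xm c by simp
  then have lt: "2 * r * xp < 2 * r * xm" using r_pos by simp
  have "2 * r * xp \<le> 2 * h * s - c" "2 * r * xp \<le> 2 * h * s + c"
    using xp_less_S12p[OF c(1)] xp_eq_S12p[OF c(1)] xp_less_S12m[OF c(1)] xp_eq_S12m[OF c(1)] le by linarith+
  then have X: "X = {W \<in> {S12p}. 2 * h * s - c = 2 * r * xp} \<union> {W \<in> {S12m}. 2 * h * s + c = 2 * r * xp} \<union>
    {W \<in> {S23p, S31p}. 2 * r * xp = 2 * r * xp} \<union> {W \<in> {S23m, S31m}. 2 * r * xm = 2 * r * xp}"
    using lt by (intro X_eq[OF c(1)]) auto
  show ?thesis
    unfolding X eq_commute[of "2 * h * s - c" "2 * r * xp"] eq_commute[of "2 * h * s + c" "2 * r * xp"]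
      xp_eq_S12p[OF c(1)] xp_eq_S12m[OF c(1)] using less_imp_neq[OF lt, symmetric] by (simp only: refl) blast
qed

lemma outer_bound:
  assumes "c < 2 * h * s" "h < s"
  shows "c < 2 * s\<^sup>2"
proof -
  have "2 * h * s \<le> 2 * s\<^sup>2" using assms s_pos by (simp add: power2_eq_square)
  then show ?thesis using assms by linarith
qed

lemma X_inner:
  assumes c: "\<bar>c\<bar> < 2 * h * s" "2 * s\<^sup>2 < c" and le: "c * (4 * s\<^sup>2 + r\<^sup>2) \<le> L"
  shows "X = {S23m, S31m} \<union> {W \<in> {S12p}. c * (4 * s\<^sup>2 + r\<^sup>2) = L}"
proof -
  have "xm < xp" using xp_less_xm[OF c(1)] xp_eq_xm[OF c(1)] c(2) by linarith
  then have lt: "2 * r * xm < 2 * r * xp" using r_pos by simp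
  have "0 < c" using c(2) by (smt (verit) zero_le_power2)
  then have "2 * h * s - c < 2 * h * s + c" by simp
  moreover have "2 * r * xm \<le> 2 * h * s - c"
    using xm_less_S12p[OF c(1)] xm_eq_S12p[OF c(1)] le by linarith
  ultimately have X: "X = {W \<in> {S12p}. 2 * h * s - c = 2 * r * xm} \<union> {W \<in> {S12m}. 2 * h * s + c = 2 * r * xm} \<union>
    {W \<in> {S23p, S31p}. 2 * r * xp = 2 * r * xm} \<union> {W \<in> {S23m, S31m}. 2 * r * xm = 2 * r * xm}"
    and neq: "2 * h * s + c \<noteq> 2 * r * xm" "2 * r * xp \<noteq> 2 * r * xm"
    using lt by (intro X_eq[OF c(1)], auto)
  show ?thesis
    unfolding X eq_commute[of "2 * h * s - c" "2 * r * xm"] xm_eq_S12p[OF c(1)] using neq by blast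
qed

text \<open>Here d^2 = d3^2 + |Z2 - Z3|^2, so the points of S23 are the ends of a diameter of the
  apex circle. Its centre has abscissa 0, hence the abscissae are opposite and near and far points
  have equal values.\<close>

lemma X_level:
  assumes c: "\<bar>c\<bar> < 2 * h * s" "c = 2 * s\<^sup>2" and le: "c * (4 * s\<^sup>2 + r\<^sup>2) \<le> L"
  shows "X = {S23p, S23m, S31p, S31m} \<union> {W \<in> {S12p}. c * (4 * s\<^sup>2 + r\<^sup>2) = L}"
proof -
  have eq: "xm = xp" using xp_eq_xm[OF c(1)] c(2) by simp
  have "0 < c" using c(2) s_pos by simp
  then have "2 * h * s - c < 2 * h * s + c" by simp
  moreover have "2 * r * xm \<le> 2 * h * s - c"
    using xm_less_S12p[OF c(1)] xm_eq_S12p[OF c(1)] le by linarith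
  ultimately have X: "X = {W \<in> {S12p}. 2 * h * s - c = 2 * r * xm} \<union> {W \<in> {S12m}. 2 * h * s + c = 2 * r * xm} \<union>
    {W \<in> {S23p, S31p}. 2 * r * xp = 2 * r * xm} \<union> {W \<in> {S23m, S31m}. 2 * r * xm = 2 * r * xm}"
    and neq: "2 * h * s + c \<noteq> 2 * r * xm"
    using eq by (intro X_eq[OF c(1)], auto)
  show ?thesis
    unfolding X eq_commute[of "2 * h * s - c" "2 * r * xm"] xm_eq_S12p[OF c(1)] using neq arg_cong[OF eq, of "(*) (2 * r)", symmetric] by (simp only: refl) blast
qed

lemma X_S12m:
  assumes c: "\<bar>c\<bar> < 2 * h * s" "c < 0" and K: "K < - c * (4 * s\<^sup>2 + r\<^sup>2)"
  shows "X = {S12m}"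
proof -
  have lt: "2 * h * s + c < 2 * r * xp" using xp_less_S12m[OF c(1)] xp_eq_S12m[OF c(1)] K by linarith
  have "c < 2 * s\<^sup>2" using c(2) by (smt (verit) zero_le_power2)
  then have "2 * r * xp < 2 * r * xm" using xp_less_xm[OF c(1)] r_pos by simp
  then show ?thesis using X_eq[OF c(1), of "2 * h * s + c"] lt c(2) by auto
qed

lemma X_S12p_convex:
  assumes "s \<le> 3 * h" "2 * h * s \<le> c"
  shows "X = {S12p}"
proof -
  have "d3\<^sup>2 \<le> (h - s)\<^sup>2" using assms(2) by (simp add: c_def power2_diff)
  \<comment> \<open>At (0, h) the base terms vanish and their multiplier is free, while the apex
    term is nonnegative and takes 1. Balance gives 2 l h = s - h; |l| <= 1 amounts to s <= 3h, and
    the multipliers add up to s/h > 0.\<close>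
  then have "minimizers Z1 Z2 Z3 d d d3 = {pt 0 h}"
    using assms(1) h_pos s_pos by (intro minimizers_axis[of "(s - h) / (2 * h)" 1]) (auto simp: d_sq field_simps)
  then show ?thesis by (simp add: near_S12)
qed

lemma X_S12m_convex:
  assumes "s \<le> h" "c \<le> - (2 * h * s)"
  shows "X = {S12m}"
proof -
  have "(- h - s)\<^sup>2 \<le> d3\<^sup>2" using assms(2) by (simp add: c_def power2_eq_square algebra_simps)
  \<comment> \<open>At (0, -h) the apex term has multiplier -1, so balance gives 2 l h = s + h. Now
    |l| <= 1 amounts to s <= h, and the sum is again s/h.\<close>
  then have "minimizers Z1 Z2 Z3 d d d3 = {pt 0 (- h)}"
    using assms(1) h_pos s_pos by (intro minimizers_axis[of "(h + s) / (2 * h)" "- 1"]) (auto simp: d_sq field_simps)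
  then show ?thesis by (simp add: far_S12)
qed

lemma d3_diff: "d3 \<le> \<bar>h - s\<bar> \<longleftrightarrow> 2 * h * s \<le> c" "d3 < \<bar>h - s\<bar> \<longleftrightarrow> 2 * h * s < c"
  and d3_sum: "d3 \<le> s + h \<longleftrightarrow> - (2 * h * s) \<le> c" "d3 < s + h \<longleftrightarrow> - (2 * h * s) < c"
proof -
  have "h\<^sup>2 + s\<^sup>2 - 2 * h * s = (h - s)\<^sup>2" "h\<^sup>2 + s\<^sup>2 - - (2 * h * s) = (s + h)\<^sup>2"
    by (simp_all add: power2_eq_square algebra_simps)
  then have "sqrt (h\<^sup>2 + s\<^sup>2 - 2 * h * s) = \<bar>h - s\<bar>" "sqrt (h\<^sup>2 + s\<^sup>2 - - (2 * h * s)) = s + h"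
    using h_pos s_pos by (simp, simp)
  note e = d3_sqrt[of "2 * h * s", unfolded this(1)] d3_sqrt[of "- (2 * h * s)", unfolded this(2)]
  show "d3 \<le> \<bar>h - s\<bar> \<longleftrightarrow> 2 * h * s \<le> c" "d3 < \<bar>h - s\<bar> \<longleftrightarrow> 2 * h * s < c"
    "d3 \<le> s + h \<longleftrightarrow> - (2 * h * s) \<le> c" "d3 < s + h \<longleftrightarrow> - (2 * h * s) < c"
    using e by linarith+
qed

lemma d3_sqrt_sum: "d3 < sqrt (h\<^sup>2 + s\<^sup>2) \<longleftrightarrow> 0 < c" "sqrt (h\<^sup>2 + s\<^sup>2) < d3 \<longleftrightarrow> c < 0" "d3 = sqrt (h\<^sup>2 + s\<^sup>2) \<longleftrightarrow> c = 0"
  using d3_sqrt[of 0] by simp_all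

lemma d3_sqrt_diff: "d3 < sqrt (h\<^sup>2 - s\<^sup>2) \<longleftrightarrow> 2 * s\<^sup>2 < c" "sqrt (h\<^sup>2 - s\<^sup>2) < d3 \<longleftrightarrow> c < 2 * s\<^sup>2" "d3 = sqrt (h\<^sup>2 - s\<^sup>2) \<longleftrightarrow> c = 2 * s\<^sup>2"
  using d3_sqrt[of "2 * s\<^sup>2"] by simp_all

text \<open>These forms compare the tie values K/(4s^2 + 9r^2) and -K/(4s^2 + r^2) of c with the
  ends 2hs and -2hs of its range. The signs change at s = 3h and s = h, which is the origin of the
  bounds sqrt(r^2/4 + s^2/9) and sqrt(r^2/4 + s^2) on d.\<close>

lemma K_bounds: "K = 2 * h * s * (4 * s\<^sup>2 + 9 * r\<^sup>2) + 8 * r\<^sup>2 * s * (s - 3 * h)"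
   "K = 2 * h * s * (4 * s\<^sup>2 + r\<^sup>2) + 8 * r\<^sup>2 * s * (s - h)"
  by (simp_all add: K_def algebra_simps power2_eq_square)

lemma K_sign:
  "s < 3 * h \<Longrightarrow> K < 2 * h * s * (4 * s\<^sup>2 + 9 * r\<^sup>2)" "3 * h < s \<Longrightarrow> 2 * h * s * (4 * s\<^sup>2 + 9 * r\<^sup>2) < K"
  "s < h \<Longrightarrow> K < 2 * h * s * (4 * s\<^sup>2 + r\<^sup>2)" "h < s \<Longrightarrow> 2 * h * s * (4 * s\<^sup>2 + r\<^sup>2) < K"
proof -
  have p: "0 < 8 * r\<^sup>2 * s" using r_pos s_pos by simp
  show "s < 3 * h \<Longrightarrow> K < 2 * h * s * (4 * s\<^sup>2 + 9 * r\<^sup>2)" "3 * h < s \<Longrightarrow> 2 * h * s * (4 * s\<^sup>2 + 9 * r\<^sup>2) < K"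
    using mult_pos_pos[OF p, of "s - 3 * h"] mult_pos_pos[OF p, of "3 * h - s"]
    unfolding K_bounds(1) by (auto simp: right_diff_distrib)
  show "s < h \<Longrightarrow> K < 2 * h * s * (4 * s\<^sup>2 + r\<^sup>2)" "h < s \<Longrightarrow> 2 * h * s * (4 * s\<^sup>2 + r\<^sup>2) < K"
    using mult_pos_pos[OF p, of "s - h"] mult_pos_pos[OF p, of "h - s"]
    unfolding K_bounds(2) by (auto simp: right_diff_distrib)
qed

text \<open>At c = 2 s^2 near and far pair have equal values, so comparing S12+ with either pair
  must give the same linear expression.\<close>

lemma K_L: "2 * s\<^sup>2 * (4 * s\<^sup>2 + 9 * r\<^sup>2) - K = 2 * s\<^sup>2 * (4 * s\<^sup>2 + r\<^sup>2) - L"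
  by (simp add: K_def L_def algebra_simps)

text \<open>At |c| = 2hs the apex circle passes through S12+ or S12-. All three circles share that
  point and the near pair collapses to it, so the listed sets remain correct at closed ends of the
  ranges.\<close>

lemma triple_points:
  assumes "\<bar>c\<bar> = 2 * h * s" "c \<le> 2 * s\<^sup>2"
  shows "S23p = pt 0 (c / (2 * s))" "S31p = pt 0 (c / (2 * s))"
proof -
  have c: "\<bar>c\<bar> \<le> 2 * h * s" using assms by simp
  have "c\<^sup>2 = (2 * h * s)\<^sup>2" using assms(1) by (metis power2_abs)
  then have "4 * s\<^sup>2 * h\<^sup>2 - c\<^sup>2 = 0" by (simp add: power_mult_distrib)
  moreover have "0 \<le> - (r * (c - 2 * s\<^sup>2))" using assms(2) r_pos by (simp add: mult_le_0_iff)
  ultimately have "xp = 0" unfolding xp_def using pos_root_zero lead_pos by simp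
  then show "S23p = pt 0 (c / (2 * s))" "S31p = pt 0 (c / (2 * s))"
    unfolding near_S23[OF c] near_S31[OF c] by simp_all
qed

lemma lead9_pos: "0 < 4 * s\<^sup>2 + 9 * r\<^sup>2"
  using r_pos by (simp add: add_nonneg_pos)

lemmas cancel = mult_less_cancel_right_pos[OF lead_pos] mult_less_cancel_right_pos[OF lead9_pos]
  mult_le_cancel_right_pos[OF lead_pos] mult_le_cancel_right_pos[OF lead9_pos]

lemma K_pos: "h < s \<Longrightarrow> 0 < K"
  using K_sign(4) mult_pos_pos[OF mult_pos_pos[OF mult_pos_pos[OF _ h_pos, of 2] s_pos] lead_pos] by linarith

lemma X_S12p_general:
  assumes "s \<le> 3 * h" "0 < c" "K < c * (4 * s\<^sup>2 + 9 * r\<^sup>2)" "c \<le> 2 * s\<^sup>2 \<or> L < c * (4 * s\<^sup>2 + r\<^sup>2)"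
  shows "X = {S12p}"
  using X_S12p X_S12p_convex assms by (cases "c < 2 * h * s") auto

lemma X_S12m_general:
  assumes "s \<le> h" "c < 0" "K < - c * (4 * s\<^sup>2 + r\<^sup>2)"
  shows "X = {S12m}"
  using X_S12m X_S12m_convex assms by (cases "- (2 * h * s) < c") auto

lemma K_le: "s \<le> 3 * h \<Longrightarrow> K \<le> 2 * h * s * (4 * s\<^sup>2 + 9 * r\<^sup>2)" "s \<le> h \<Longrightarrow> K \<le> 2 * h * s * (4 * s\<^sup>2 + r\<^sup>2)"
  using K_sign(1,3) K_bounds by (auto simp: le_less)

lemma X_outer_strict:
  assumes "\<bar>c\<bar> < 2 * h * s" "c < 2 * s\<^sup>2" "c * (4 * s\<^sup>2 + 9 * r\<^sup>2) < K" "- c * (4 * s\<^sup>2 + r\<^sup>2) < K"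
  shows "X = {S23p, S31p}"
proof -
  have "c * (4 * s\<^sup>2 + 9 * r\<^sup>2) \<noteq> K" "- c * (4 * s\<^sup>2 + r\<^sup>2) \<noteq> K" using assms by linarith+
  then show ?thesis using X_outer[OF assms(1,2)] assms(3,4) by (simp only: order.strict_implies_order simp_thms) blast
qed

lemma S23_S31_at_sum:
  assumes "c = - (2 * h * s)"
  shows "S23p = pt 0 (- h)" "S31p = pt 0 (- h)"
proof -
  have "c \<le> 2 * s\<^sup>2" using assms h_pos s_pos by (smt (verit) mult_pos_pos zero_le_power2)
  moreover have "\<bar>c\<bar> = 2 * h * s" using assms h_pos s_pos by simp
  ultimately show "S23p = pt 0 (- h)" "S31p = pt 0 (- h)"
    using triple_points s_pos by (simp_all add: assms)
qed

lemma X_at_M: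
  assumes "s \<le> h" "0 < K" "- c * (4 * s\<^sup>2 + r\<^sup>2) = K"
  shows "X = {S23p, S31p, S12m}"
proof -
  have "0 < - c" using assms(2,3) lead_pos by (metis zero_less_mult_pos2)
  then have "c < 2 * s\<^sup>2" by (smt (verit) zero_le_power2)
  have "- c \<le> 2 * h * s" using K_le(2)[OF assms(1)] assms(3) cancel(3)[of "- c"] by simp
  show ?thesis
  proof (cases "- c = 2 * h * s")
    \<comment> \<open>By \<open>K_bounds\<close> this occurs only for s = h. Then M = s + h and all
      listed points are S12-.\<close>
    case True
    then have "X = {S12m}" "S23p = pt 0 (- h)" "S31p = pt 0 (- h)"
      using X_S12m_convex[OF assms(1)] S23_S31_at_sum by auto
    then show ?thesis by (simp add: far_S12)
  next
    case False
    then have c: "\<bar>c\<bar> < 2 * h * s" using \<open>0 < - c\<close> \<open>- c \<le> _\<close> by simp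
    have "c * (4 * s\<^sup>2 + 9 * r\<^sup>2) < 0" using \<open>0 < - c\<close> lead9_pos by (simp add: mult_neg_pos)
    then have "c * (4 * s\<^sup>2 + 9 * r\<^sup>2) \<le> K" "c * (4 * s\<^sup>2 + 9 * r\<^sup>2) \<noteq> K" using assms(2) by linarith+
    then show ?thesis using X_outer[OF c \<open>c < 2 * s\<^sup>2\<close>] assms(3) by (simp only: order_refl simp_thms) blast
  qed
qed

lemma X_at_R:
  assumes "s \<le> 3 * h" "0 < K" "c * (4 * s\<^sup>2 + 9 * r\<^sup>2) = K" "c < 2 * s\<^sup>2"
  shows "X = {S12p, S23p, S31p}"
proof -
  have "0 < c" using assms(2,3) lead9_pos by (metis zero_less_mult_pos2)
  have "c \<le> 2 * h * s" using K_le(1)[OF assms(1)] assms(3) cancel(4)[of c] by simp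
  show ?thesis
  proof (cases "c = 2 * h * s")
    \<comment> \<open>By \<open>K_bounds\<close> this occurs only for s = 3h. Then R = s - h and all
      listed points are S12+.\<close>
    case True
    then have "S23p = pt 0 h" "S31p = pt 0 h" "X = {S12p}"
      using triple_points X_S12p_convex[OF assms(1)] assms(4) h_pos s_pos by simp_all
    then show ?thesis by (simp add: near_S12)
  next
    case False
    then have c: "\<bar>c\<bar> < 2 * h * s" using \<open>0 < c\<close> \<open>c \<le> _\<close> by simp
    have "0 < c * (4 * s\<^sup>2 + r\<^sup>2)" using \<open>0 < c\<close> lead_pos by simp
    then have "- c * (4 * s\<^sup>2 + r\<^sup>2) \<le> K" "- c * (4 * s\<^sup>2 + r\<^sup>2) \<noteq> K" using assms(2) by linarith+
    then show ?thesis using X_outer[OF c assms(4)] assms(3) by (simp only: order_refl simp_thms) blast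
  qed
qed

lemma X_between:
  assumes "s \<le> h" "K < 2 * s\<^sup>2 * (4 * s\<^sup>2 + 9 * r\<^sup>2) \<or> c < 2 * s\<^sup>2" "c * (4 * s\<^sup>2 + 9 * r\<^sup>2) < K" "- c * (4 * s\<^sup>2 + r\<^sup>2) < K"
  shows "X = {S23p, S31p}"
proof (rule X_outer_strict[OF _ _ assms(3,4)])
  show "c < 2 * s\<^sup>2" using assms(2,3) cancel(2)[of c "2 * s\<^sup>2"] by linarith
  have "c < 2 * h * s" using assms(3) K_le(1) cancel(2)[of c "2 * h * s"] assms(1) h_pos by linarith
  moreover have "- c < 2 * h * s" using assms(4) K_le(2) cancel(1)[of "- c" "2 * h * s"] assms(1) by linarith
  ultimately show "\<bar>c\<bar> < 2 * h * s" by linarith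
qed

lemma X_short_radii:
  assumes "3 * h < s" "d3 \<in> {s - h<..<s + h}"
  shows "X = {S23p, S31p}"
proof -
  have "\<bar>h - s\<bar> = s - h" using assms h_pos by simp
  then have c: "\<bar>c\<bar> < 2 * h * s" using d3_diff d3_sum assms(2) by (auto simp: abs_less_iff)
  then have "c < 2 * s\<^sup>2" using outer_bound assms(1) h_pos by simp
  moreover have "c * (4 * s\<^sup>2 + 9 * r\<^sup>2) < K"
    using c K_sign(2)[OF assms(1)] cancel(2)[of c "2 * h * s"] by linarith
  moreover have "- c * (4 * s\<^sup>2 + r\<^sup>2) < K"
    using c K_sign(4) cancel(1)[of "- c" "2 * h * s"] assms(1) h_pos by linarith
  ultimately show ?thesis using X_outer_strict c by blast
qed

lemma X_small_d3: "s \<le> 3 * h \<Longrightarrow> d3 \<le> \<bar>s - h\<bar> \<Longrightarrow> X = {S12p}"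
  using X_S12p_convex d3_diff by (simp add: abs_minus_commute)

lemma X_medium_radii:
  assumes "s \<le> 3 * h" "h < s"
  shows "d3 < thr_R r s d \<Longrightarrow> X = {S12p}"
    and "d3 = thr_R r s d \<Longrightarrow> X = {S12p, S23p, S31p}"
    and "thr_R r s d < d3 \<Longrightarrow> d3 \<le> s + h \<Longrightarrow> X = {S23p, S31p}"
proof -
  have K: "0 < K" using K_pos assms(2) .
  {
    assume "d3 < thr_R r s d"
    then have R: "K < c * (4 * s\<^sup>2 + 9 * r\<^sup>2)" using d3_R by simp
    then have "0 < c * (4 * s\<^sup>2 + 9 * r\<^sup>2)" using K by linarith
    then have "0 < c" using lead9_pos by (metis zero_less_mult_pos2)
    show "X = {S12p}"
    proof (cases "c < 2 * h * s")
      case True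
      then show ?thesis using X_S12p_general outer_bound \<open>0 < c\<close> R assms by force
    qed (use X_S12p_convex assms in auto)
  next
    assume "d3 = thr_R r s d"
    then have R: "c * (4 * s\<^sup>2 + 9 * r\<^sup>2) = K" using d3_R by simp
    have "c \<le> 2 * h * s" using K_le(1)[OF assms(1)] R cancel(4)[of c] by simp
    moreover have "2 * h * s < 2 * s\<^sup>2" using assms(2) s_pos by (simp add: power2_eq_square)
    ultimately have "c < 2 * s\<^sup>2" by linarith
    then show "X = {S12p, S23p, S31p}" using X_at_R[OF assms(1) K R] by simp
  next
    assume "thr_R r s d < d3" and d3: "d3 \<le> s + h"
    then have R: "c * (4 * s\<^sup>2 + 9 * r\<^sup>2) < K" using d3_R by simp
    have c: "c < 2 * h * s" "- (2 * h * s) \<le> c"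
      using K_le(1)[OF assms(1)] R cancel(2)[of c "2 * h * s"] d3_sum(1) d3 by linarith+
    show "X = {S23p, S31p}"
    proof (cases "c = - (2 * h * s)")
      \<comment> \<open>The closed end d3 = s + h lies outside the open range of the rhombus
        argument; the bound on the axis gives the common point there.\<close>
      case True
      then have "d3 = s + h" using d3_sum d3 by linarith
      moreover have "X = {pt 0 (s - d3)}"
        using assms h_pos s_pos by (intro minimizers_N3) (auto simp: \<open>d3 = s + h\<close> d_sq)
      ultimately show ?thesis using S23_S31_at_sum[OF True] by simp
    next
      case False
      then have c': "\<bar>c\<bar> < 2 * h * s" using c by linarith
      have "- c * (4 * s\<^sup>2 + r\<^sup>2) < K"
        using c c' K_sign(4)[OF assms(2)] cancel(1)[of "- c" "2 * h * s"] by linarith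
      then show ?thesis using X_outer_strict[OF c' outer_bound] c assms(2) R by blast
    qed
  }
qed

text \<open>By \<open>K_L\<close> the tie of S12+ with the near pair occurs at some c < 2 s^2. When
  c rises to the level where the far pair takes over, S12+ is already ahead, so the far pair never
  becomes optimal.\<close>

lemma X_below_crossing:
  assumes "s \<le> h" "0 < K" "L < 2 * s\<^sup>2 * (4 * s\<^sup>2 + r\<^sup>2)"
  shows "d3 < thr_R r s d \<Longrightarrow> X = {S12p}"
    and "d3 = thr_R r s d \<Longrightarrow> X = {S12p, S23p, S31p}"
    and "thr_R r s d < d3 \<Longrightarrow> d3 < thr_M r s d \<Longrightarrow> X = {S23p, S31p}"
proof -
  have h3: "s \<le> 3 * h" using assms(1) h_pos by simp
  have K: "K < 2 * s\<^sup>2 * (4 * s\<^sup>2 + 9 * r\<^sup>2)" using K_L assms(3) by linarith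
  {
    assume "d3 < thr_R r s d"
    then have R: "K < c * (4 * s\<^sup>2 + 9 * r\<^sup>2)" using d3_R by simp
    then have "0 < c * (4 * s\<^sup>2 + 9 * r\<^sup>2)" using assms(2) by linarith
    then have "0 < c" using lead9_pos by (metis zero_less_mult_pos2)
    moreover have "c \<le> 2 * s\<^sup>2 \<or> L < c * (4 * s\<^sup>2 + r\<^sup>2)"
      using cancel(1)[of "2 * s\<^sup>2" c] assms(3) by linarith
    ultimately show "X = {S12p}" using X_S12p_general[OF h3] R by blast
  next
    assume "d3 = thr_R r s d"
    then have R: "c * (4 * s\<^sup>2 + 9 * r\<^sup>2) = K" using d3_R by simp
    then have "c < 2 * s\<^sup>2" using K cancel(2)[of c "2 * s\<^sup>2"] by simp
    then show "X = {S12p, S23p, S31p}" using X_at_R[OF h3 assms(2) R] by simp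
  next
    assume "thr_R r s d < d3" "d3 < thr_M r s d"
    then show "X = {S23p, S31p}" using X_between assms(1) K d3_R d3_M by blast
  }
qed

lemma X_above_M:
  assumes "s \<le> h" "0 < K" "thr_M r s d < d3"
  shows "X = {S12m}"
proof -
  have M: "K < - c * (4 * s\<^sup>2 + r\<^sup>2)" using d3_M assms(3) by simp
  then have "0 < - c * (4 * s\<^sup>2 + r\<^sup>2)" using assms(2) by linarith
  then have "0 < - c" using lead_pos by (metis zero_less_mult_pos2)
  then show ?thesis using X_S12m_general assms(1) M by simp
qed

lemma L_neg: "4 * s\<^sup>2 < 3 * r\<^sup>2 \<Longrightarrow> L < 0"
proof -
  assume "4 * s\<^sup>2 < 3 * r\<^sup>2"
  then have "2 * h * s * (4 * s\<^sup>2 - 3 * r\<^sup>2) < 0" using h_pos s_pos by (intro mult_pos_neg) auto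
  then show "L < 0" unfolding L_def by (smt (verit) zero_le_mult_iff zero_le_power2)
qed

text \<open>The values of S12+ and S12- are 2hs - c and 2hs + c and change order at c = 0. For K <=
  0 the near pair can at best tie with them at that single level.\<close>

lemma X_beyond_T:
  assumes "4 * s\<^sup>2 < 3 * r\<^sup>2" "s \<le> h" "K \<le> 0"
  shows "0 < c \<Longrightarrow> X = {S12p}"
    and "c < 0 \<Longrightarrow> X = {S12m}"
    and "c = 0 \<Longrightarrow> K = 0 \<Longrightarrow> X = {S12p, S12m, S23p, S31p}"
    and "c = 0 \<Longrightarrow> K < 0 \<Longrightarrow> X = {S12p, S12m}"
proof -
  have h3: "s \<le> 3 * h" using assms(2) h_pos by simp
  {
    assume "0 < c"
    then have "0 < c * (4 * s\<^sup>2 + 9 * r\<^sup>2)" "0 < c * (4 * s\<^sup>2 + r\<^sup>2)" using lead_pos lead9_pos by simp_all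
    then have "K < c * (4 * s\<^sup>2 + 9 * r\<^sup>2)" "L < c * (4 * s\<^sup>2 + r\<^sup>2)" using assms(3) L_neg[OF assms(1)] by linarith+
    then show "X = {S12p}" using X_S12p_general[OF h3 \<open>0 < c\<close>] by simp
  next
    assume "c < 0"
    then have "0 < - c * (4 * s\<^sup>2 + r\<^sup>2)" using lead_pos by (intro mult_pos_pos) auto
    then have "K < - c * (4 * s\<^sup>2 + r\<^sup>2)" using assms(3) by linarith
    then show "X = {S12m}" using X_S12m_general[OF assms(2) \<open>c < 0\<close>] by simp
  next
    assume "c = 0"
    then have c: "\<bar>c\<bar> < 2 * h * s" "c < 2 * s\<^sup>2" using h_pos s_pos by simp_all
    {
      assume "K = 0"
      then have "c * (4 * s\<^sup>2 + 9 * r\<^sup>2) = K" "- c * (4 * s\<^sup>2 + r\<^sup>2) = K" using \<open>c = 0\<close> by simp_all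
      then show "X = {S12p, S12m, S23p, S31p}" using X_outer[OF c] by (simp only: order_refl simp_thms) blast
    next
      assume "K < 0"
      then have lt: "2 * h * s - c < 2 * r * xp"
        using xp_less_S12p[OF c(1)] xp_eq_S12p[OF c(1)] \<open>c = 0\<close> by (simp add: not_less)
      moreover have "xp < xm" using xp_less_xm[OF c(1)] c(2) by simp
      then have "2 * r * xp < 2 * r * xm" using r_pos by simp
      ultimately show "X = {S12p, S12m}"
        using X_eq[OF c(1), of "2 * h * s - c"] \<open>c = 0\<close> by auto
    }
  }
qed

text \<open>In the tall case this places P above sqrt(r^2/4 + s^2), so from d >= P on the results
  for s <= h are available.\<close>

lemma s_less_h:
  assumes "3 * r\<^sup>2 < 4 * s\<^sup>2" "2 * s\<^sup>2 * (4 * s\<^sup>2 + r\<^sup>2) \<le> L"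
  shows "s < h"
proof (rule ccontr)
  assume "\<not> s < h"
  then have "2 * h * s * (4 * s\<^sup>2 - 3 * r\<^sup>2) \<le> 2 * s * s * (4 * s\<^sup>2 - 3 * r\<^sup>2)"
    using assms(1) s_pos by (intro mult_right_mono) auto
  moreover have "2 * s * s * (4 * s\<^sup>2 - 3 * r\<^sup>2) - 8 * r\<^sup>2 * s\<^sup>2 = 2 * s\<^sup>2 * (4 * s\<^sup>2 + r\<^sup>2) - 16 * (r\<^sup>2 * s\<^sup>2)"
    by (simp add: power2_eq_square algebra_simps)
  moreover have "0 < r\<^sup>2 * s\<^sup>2" using r_pos s_pos by simp
  ultimately show False using assms(2) unfolding L_def by linarith
qed

lemma L_less: "L < 2 * h * s * (4 * s\<^sup>2 + r\<^sup>2)"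
proof -
  have "2 * h * s * (4 * s\<^sup>2 + r\<^sup>2) - L = 8 * h * s * r\<^sup>2 + 8 * r\<^sup>2 * s\<^sup>2"
    by (simp add: L_def algebra_simps)
  moreover have "0 < 8 * h * s * r\<^sup>2 + 8 * r\<^sup>2 * s\<^sup>2" using h_pos s_pos r_pos by (intro add_pos_pos) auto
  ultimately show ?thesis by linarith
qed

lemma K_pos_tall: "3 * r\<^sup>2 < 4 * s\<^sup>2 \<Longrightarrow> 0 < K"
  unfolding K_def using h_pos s_pos r_pos by (intro add_pos_pos mult_pos_pos) auto

text \<open>As d3 grows, c falls. S12+ first meets the far pair, at c = L/(4s^2 + r^2) >= 2 s^2; the
  far pair then leads down to c = 2 s^2, where the near pair takes over. For equality in
  \<open>L\<close> both events coincide.\<close>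

lemma X_above_crossing:
  assumes rs: "3 * r\<^sup>2 < 4 * s\<^sup>2" and L: "2 * s\<^sup>2 * (4 * s\<^sup>2 + r\<^sup>2) \<le> L"
  shows "L < c * (4 * s\<^sup>2 + r\<^sup>2) \<Longrightarrow> X = {S12p}"
    and "2 * s\<^sup>2 < c \<Longrightarrow> c * (4 * s\<^sup>2 + r\<^sup>2) = L \<Longrightarrow> X = {S12p, S23m, S31m}"
    and "2 * s\<^sup>2 < c \<Longrightarrow> c * (4 * s\<^sup>2 + r\<^sup>2) < L \<Longrightarrow> X = {S23m, S31m}"
    and "c = 2 * s\<^sup>2 \<Longrightarrow> c * (4 * s\<^sup>2 + r\<^sup>2) = L \<Longrightarrow> X = {S12p, S23p, S23m, S31p, S31m}"
    and "c = 2 * s\<^sup>2 \<Longrightarrow> c * (4 * s\<^sup>2 + r\<^sup>2) < L \<Longrightarrow> X = {S23p, S23m, S31p, S31m}"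
    and "0 \<le> c \<Longrightarrow> c < 2 * s\<^sup>2 \<Longrightarrow> X = {S23p, S31p}"
proof -
  have sh: "s < h" using s_less_h[OF rs L] .
  then have h3: "s \<le> 3 * h" using h_pos by simp
  have s2: "0 < 2 * s\<^sup>2" using s_pos by simp
  have "s\<^sup>2 < h * s" using sh s_pos by (simp add: power2_eq_square)
  then have level: "2 * s\<^sup>2 < 2 * h * s" by simp
  have less: "c < 2 * h * s" if "c * (4 * s\<^sup>2 + r\<^sup>2) \<le> L"
    using that L_less cancel(1)[of c "2 * h * s"] by linarith
  {
    assume c: "L < c * (4 * s\<^sup>2 + r\<^sup>2)"
    then have "2 * s\<^sup>2 < c" using L cancel(1)[of "2 * s\<^sup>2" c] by linarith
    then have "2 * s\<^sup>2 * (8 * r\<^sup>2) < c * (8 * r\<^sup>2)" using r_pos by simp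
    then have "K < c * (4 * s\<^sup>2 + 9 * r\<^sup>2)" using c K_L by (simp add: algebra_simps)
    then show "X = {S12p}" using X_S12p_general[OF h3] \<open>2 * s\<^sup>2 < c\<close> s2 c by simp
  next
    assume c: "2 * s\<^sup>2 < c" "c * (4 * s\<^sup>2 + r\<^sup>2) = L"
    then have "\<bar>c\<bar> < 2 * h * s" using less[OF eq_refl[OF c(2)]] s2 by linarith
    from X_inner[OF this c(1)] show "X = {S12p, S23m, S31m}" using c(2) by (simp only: order_refl simp_thms) blast
  next
    assume c: "2 * s\<^sup>2 < c" "c * (4 * s\<^sup>2 + r\<^sup>2) < L"
    then have "\<bar>c\<bar> < 2 * h * s" using less[OF less_imp_le[OF c(2)]] s2 by linarith
    from X_inner[OF this c(1)] show "X = {S23m, S31m}"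
      using less_imp_le[OF c(2)] less_imp_neq[OF c(2)] by (simp only: simp_thms) blast
  next
    assume c: "c = 2 * s\<^sup>2" "c * (4 * s\<^sup>2 + r\<^sup>2) = L"
    then have "\<bar>c\<bar> < 2 * h * s" using level s2 by linarith
    from X_level[OF this c(1)] show "X = {S12p, S23p, S23m, S31p, S31m}" using c(2) by (simp only: order_refl simp_thms) blast
  next
    assume c: "c = 2 * s\<^sup>2" "c * (4 * s\<^sup>2 + r\<^sup>2) < L"
    then have "\<bar>c\<bar> < 2 * h * s" using level s2 by linarith
    from X_level[OF this c(1)] show "X = {S23p, S23m, S31p, S31m}"
      using less_imp_le[OF c(2)] less_imp_neq[OF c(2)] by (simp only: simp_thms) blast
  next
    assume c: "0 \<le> c" "c < 2 * s\<^sup>2"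
    have "c * (4 * s\<^sup>2 + 9 * r\<^sup>2) < K" using K_L L c(2) cancel(2)[of c "2 * s\<^sup>2"] by linarith
    moreover have "0 \<le> c * (4 * s\<^sup>2 + r\<^sup>2)" using c(1) lead_pos by simp
    then have "- c * (4 * s\<^sup>2 + r\<^sup>2) < K" using K_pos_tall[OF rs] by linarith
    ultimately show "X = {S23p, S31p}" using X_between[OF less_imp_le[OF sh]] c(2) by blast
  }
qed

section \<open>The threshold \<open>d3_star\<close> in closed form\<close>

lemma norm_Z1_Z2: "norm (Z1 - Z2) = r"
proof -
  have "(norm (Z1 - Z2))\<^sup>2 = r\<^sup>2" unfolding norm_pt_diff by (simp add: power2_eq_square field_simps)
  then show ?thesis using r_pos by (simp add: power2_eq_iff_nonneg)
qed

lemma midpoint_eq: "(1/2) *\<^sub>R (Z1 + Z2) = pt 0 0"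
  by (simp add: pt_def scaleR_add_right flip: scaleR_add_left)

lemma norm_height: "norm (Z3 - (1/2) *\<^sub>R (Z1 + Z2)) = s"
proof -
  have "(norm (Z3 - pt 0 0))\<^sup>2 = s\<^sup>2" unfolding norm_pt_diff by simp
  then show ?thesis unfolding midpoint_eq using s_pos by (simp add: power2_eq_iff_nonneg)
qed

lemma obj_crossing:
  assumes "s < h" "d3 \<in> {h - s<..<sqrt (h\<^sup>2 - s\<^sup>2)}"
  shows "obj S23m = obj S12p \<longleftrightarrow> d3 = sqrt (h\<^sup>2 + s\<^sup>2 - L / (4 * s\<^sup>2 + r\<^sup>2))"
proof -
  have "c < 2 * h * s" "2 * s\<^sup>2 < c" using assms d3_diff d3_sqrt_diff by auto
  moreover have "0 \<le> s\<^sup>2" by simp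
  ultimately have c: "\<bar>c\<bar> < 2 * h * s" by linarith
  have "obj S23m = obj S12p \<longleftrightarrow> 2 * r * xm = 2 * h * s - c"
    using c obj_S23m obj_S12p by simp
  also have "\<dots> \<longleftrightarrow> c = L / (4 * s\<^sup>2 + r\<^sup>2)"
    unfolding xm_eq_S12p[OF c] using lead_pos by (auto simp: eq_divide_eq)
  finally show ?thesis unfolding d3_sqrt .
qed

text \<open>The tie condition is linear in c, so it has exactly one solution. The bounds 2 s^2 <
  L/(4s^2 + r^2) < 2hs place it inside the interval required by the \<open>THE\<close>
  description.\<close>

lemma d3_star_eq:
  assumes rs: "3 * r\<^sup>2 < 4 * s\<^sup>2" and L: "2 * s\<^sup>2 * (4 * s\<^sup>2 + r\<^sup>2) < L"
  shows "d3_star Z1 Z2 Z3 d = sqrt (h\<^sup>2 + s\<^sup>2 - L / (4 * s\<^sup>2 + r\<^sup>2))"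
proof -
  let ?D = "sqrt (h\<^sup>2 + s\<^sup>2 - L / (4 * s\<^sup>2 + r\<^sup>2))"
  have sh: "s < h" using s_less_h[OF rs] L by simp
  have cross: "objective Z1 Z2 Z3 d d x (far_point Z2 d Z3 x Z1) = objective Z1 Z2 Z3 d d x (near_point Z1 d Z2 d Z3)
      \<longleftrightarrow> x = ?D" if x: "x \<in> {h - s<..<sqrt (h\<^sup>2 - s\<^sup>2)}" for x
  proof -
    \<comment> \<open>Both \<open>c\<close> and \<open>xm\<close> depend on the third radius, so the
      locale is instantiated anew with x in its place.\<close>
    have "0 < x" using x sh by auto
    then interpret x: isosceles_circles mid f g r s d x h
      using d_pos h_pos d_sq by unfold_locales
    show ?thesis using x.obj_crossing[OF sh x] .
  qed
  have "2 * s\<^sup>2 < L / (4 * s\<^sup>2 + r\<^sup>2)" "L / (4 * s\<^sup>2 + r\<^sup>2) < 2 * h * s"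
    using L L_less lead_pos by (simp_all add: pos_less_divide_eq pos_divide_less_eq)
  then have "?D < sqrt (h\<^sup>2 - s\<^sup>2)" "sqrt ((h - s)\<^sup>2) < ?D"
    unfolding real_sqrt_less_iff power2_diff by linarith+
  then have "?D \<in> {h - s<..<sqrt (h\<^sup>2 - s\<^sup>2)}" using sh by simp
  then show ?thesis
    unfolding d3_star_def Let_def norm_height norm_Z1_Z2 thr_h using cross by (intro the_equality) auto
qed

lemma d3_D:
  assumes "3 * r\<^sup>2 < 4 * s\<^sup>2" "2 * s\<^sup>2 * (4 * s\<^sup>2 + r\<^sup>2) < L"
  shows "d3 < d3_star Z1 Z2 Z3 d \<longleftrightarrow> L < c * (4 * s\<^sup>2 + r\<^sup>2)" "d3_star Z1 Z2 Z3 d < d3 \<longleftrightarrow> c * (4 * s\<^sup>2 + r\<^sup>2) < L"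
    "d3 = d3_star Z1 Z2 Z3 d \<longleftrightarrow> c * (4 * s\<^sup>2 + r\<^sup>2) = L"
  unfolding d3_star_eq[OF assms] d3_sqrt pos_divide_less_eq[OF lead_pos] pos_less_divide_eq[OF lead_pos] eq_divide_eq
  using lead_pos by auto

section \<open>Classification by ranges of \<open>d\<close> and \<open>d3\<close> within the
  frame\<close>

lemma d_thresholds:
  "d < sqrt (r\<^sup>2 / 4 + s\<^sup>2) \<longleftrightarrow> h < s" "d < sqrt (r\<^sup>2 / 4 + s\<^sup>2 / 9) \<longleftrightarrow> 3 * h < s"
  "d \<le> sqrt (r\<^sup>2 / 4 + s\<^sup>2) \<longleftrightarrow> h \<le> s" "d \<le> sqrt (r\<^sup>2 / 4 + s\<^sup>2 / 9) \<longleftrightarrow> 3 * h \<le> s"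
proof -
  have "s\<^sup>2 / 9 = (s / 3)\<^sup>2" by (simp add: power_divide)
  then show "d < sqrt (r\<^sup>2 / 4 + s\<^sup>2) \<longleftrightarrow> h < s" "d < sqrt (r\<^sup>2 / 4 + s\<^sup>2 / 9) \<longleftrightarrow> 3 * h < s"
    "d \<le> sqrt (r\<^sup>2 / 4 + s\<^sup>2) \<longleftrightarrow> h \<le> s" "d \<le> sqrt (r\<^sup>2 / 4 + s\<^sup>2 / 9) \<longleftrightarrow> 3 * h \<le> s"
    using d_less_sqrt[of s] d_less_sqrt[of "s / 3"] s_pos by (auto simp: le_less)
qed

lemma classification_any_height:
  "d \<le> sqrt (r\<^sup>2 / 4 + s\<^sup>2 / 9) \<Longrightarrow> d3 \<in> {2 * s / 3..s - h} \<Longrightarrow> X = {pt 0 (s - d3)}"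
  "d \<le> sqrt (r\<^sup>2 / 4 + s\<^sup>2) \<Longrightarrow> d3 \<in> {s + h..2 * s} \<Longrightarrow> X = {pt 0 (s - d3)}"
  "d < sqrt (r\<^sup>2 / 4 + s\<^sup>2 / 9) \<Longrightarrow> d3 \<in> {s - h<..<s + h} \<Longrightarrow> X = {S23p, S31p}"
  "sqrt (r\<^sup>2 / 4 + s\<^sup>2 / 9) \<le> d \<Longrightarrow> d3 \<in> {0<..\<bar>s - h\<bar>} \<Longrightarrow> X = {S12p}"
  "d \<in> {sqrt (r\<^sup>2 / 4 + s\<^sup>2 / 9)..<sqrt (r\<^sup>2 / 4 + s\<^sup>2)} \<Longrightarrow>
     (d3 \<in> {s - h..<thr_R r s d} \<longrightarrow> X = {S12p}) \<and>
     (d3 = thr_R r s d \<longrightarrow> X = {S12p, S23p, S31p}) \<and>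
     (d3 \<in> {thr_R r s d<..s + h} \<longrightarrow> X = {S23p, S31p})"
proof -
  have N3: "X = {pt 0 (s - d3)}" if "2 * s / 3 \<le> d3" "d3 \<le> 2 * s" "h \<le> \<bar>s - d3\<bar>"
  proof -
    have "h\<^sup>2 \<le> (s - d3)\<^sup>2" using that(3) h_pos by (simp flip: abs_le_square_iff)
    then show ?thesis using minimizers_N3[OF that(1,2)] by (simp add: d_sq)
  qed
  show "X = {pt 0 (s - d3)}" if "d3 \<in> {2 * s / 3..s - h}"
    using that h_pos s_pos by (intro N3) auto
  show "X = {pt 0 (s - d3)}" if "d3 \<in> {s + h..2 * s}"
    using that h_pos s_pos by (intro N3) auto
  show "X = {S23p, S31p}" if "d < sqrt (r\<^sup>2 / 4 + s\<^sup>2 / 9)" "d3 \<in> {s - h<..<s + h}"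
    using that X_short_radii d_thresholds by blast
  show "X = {S12p}" if "sqrt (r\<^sup>2 / 4 + s\<^sup>2 / 9) \<le> d" "d3 \<in> {0<..\<bar>s - h\<bar>}"
    using that X_small_d3 d_thresholds(2) by (simp flip: not_less)
  show "(d3 \<in> {s - h..<thr_R r s d} \<longrightarrow> X = {S12p}) \<and>
     (d3 = thr_R r s d \<longrightarrow> X = {S12p, S23p, S31p}) \<and>
     (d3 \<in> {thr_R r s d<..s + h} \<longrightarrow> X = {S23p, S31p})"
    if "d \<in> {sqrt (r\<^sup>2 / 4 + s\<^sup>2 / 9)..<sqrt (r\<^sup>2 / 4 + s\<^sup>2)}"
  proof -
    have "s \<le> 3 * h" "h < s" using that d_thresholds(1,2) by (auto simp flip: not_less)
    from X_medium_radii[OF this] show ?thesis unfolding greaterThanAtMost_iff atLeastLessThan_iff by iprover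
  qed
qed

lemma classification_flat:
  assumes rs: "4 * s\<^sup>2 < 3 * r\<^sup>2"
  shows "d \<in> {sqrt (r\<^sup>2 / 4 + s\<^sup>2)..<thr_T r s} \<Longrightarrow>
     (d3 \<in> {h - s..<thr_R r s d} \<longrightarrow> X = {S12p}) \<and>
     (d3 = thr_R r s d \<longrightarrow> X = {S12p, S23p, S31p}) \<and>
     (d3 \<in> {thr_R r s d<..<thr_M r s d} \<longrightarrow> X = {S23p, S31p}) \<and>
     (d3 = thr_M r s d \<longrightarrow> X = {S23p, S31p, S12m}) \<and>
     (d3 \<in> {thr_M r s d<..} \<longrightarrow> X = {S12m})"
    and "d = thr_T r s \<Longrightarrow>
     (d3 \<in> {h - s..<sqrt (h\<^sup>2 + s\<^sup>2)} \<longrightarrow> X = {S12p}) \<and>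
     (d3 = sqrt (h\<^sup>2 + s\<^sup>2) \<longrightarrow> X = {S12p, S12m, S23p, S31p}) \<and>
     (d3 \<in> {sqrt (h\<^sup>2 + s\<^sup>2)<..} \<longrightarrow> X = {S12m})"
    and "thr_T r s < d \<Longrightarrow>
     (d3 \<in> {h - s..<sqrt (h\<^sup>2 + s\<^sup>2)} \<longrightarrow> X = {S12p}) \<and>
     (d3 = sqrt (h\<^sup>2 + s\<^sup>2) \<longrightarrow> X = {S12p, S12m}) \<and>
     (d3 \<in> {sqrt (h\<^sup>2 + s\<^sup>2)<..} \<longrightarrow> X = {S12m})"
proof -
  have K_le0: "s \<le> h" if "K \<le> 0" using K_pos that by force
  show "(d3 \<in> {h - s..<thr_R r s d} \<longrightarrow> X = {S12p}) \<and>
     (d3 = thr_R r s d \<longrightarrow> X = {S12p, S23p, S31p}) \<and>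
     (d3 \<in> {thr_R r s d<..<thr_M r s d} \<longrightarrow> X = {S23p, S31p}) \<and>
     (d3 = thr_M r s d \<longrightarrow> X = {S23p, S31p, S12m}) \<and>
     (d3 \<in> {thr_M r s d<..} \<longrightarrow> X = {S12m})" if "d \<in> {sqrt (r\<^sup>2 / 4 + s\<^sup>2)..<thr_T r s}"
  proof -
    have K: "0 < K" "s \<le> h" using that d_T[OF rs] d_thresholds(1) by (auto simp flip: not_less)
    \<comment> \<open>A flat triangle has L < 0, so the lemma for radii below the crossing with the
      far pair applies.\<close>
    have "0 \<le> 2 * s\<^sup>2 * (4 * s\<^sup>2 + r\<^sup>2)" by simp
    then have L: "L < 2 * s\<^sup>2 * (4 * s\<^sup>2 + r\<^sup>2)" using L_neg[OF rs] by linarith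
    show ?thesis
      unfolding greaterThanLessThan_iff atLeastLessThan_iff greaterThan_iff d3_M(3)
      using X_below_crossing[OF K(2,1) L] X_at_M[OF K(2,1)] X_above_M[OF K(2,1)] by iprover
  qed
  show "(d3 \<in> {h - s..<sqrt (h\<^sup>2 + s\<^sup>2)} \<longrightarrow> X = {S12p}) \<and>
     (d3 = sqrt (h\<^sup>2 + s\<^sup>2) \<longrightarrow> X = {S12p, S12m, S23p, S31p}) \<and>
     (d3 \<in> {sqrt (h\<^sup>2 + s\<^sup>2)<..} \<longrightarrow> X = {S12m})" if "d = thr_T r s"
  proof -
    have K: "K = 0" "K \<le> 0" using that d_T(2)[OF rs] by auto
    show ?thesis
      unfolding atLeastLessThan_iff greaterThan_iff d3_sqrt_sum
      using X_beyond_T[OF rs K_le0[OF K(2)] K(2)] K(1) by iprover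
  qed
  show "(d3 \<in> {h - s..<sqrt (h\<^sup>2 + s\<^sup>2)} \<longrightarrow> X = {S12p}) \<and>
     (d3 = sqrt (h\<^sup>2 + s\<^sup>2) \<longrightarrow> X = {S12p, S12m}) \<and>
     (d3 \<in> {sqrt (h\<^sup>2 + s\<^sup>2)<..} \<longrightarrow> X = {S12m})" if "thr_T r s < d"
  proof -
    have K: "K < 0" "K \<le> 0" using that d_T(3)[OF rs] by auto
    show ?thesis
      unfolding atLeastLessThan_iff greaterThan_iff d3_sqrt_sum
      using X_beyond_T[OF rs K_le0[OF K(2)] K(2)] K(1) by iprover
  qed
qed

lemma classification_tall:
  assumes rs: "3 * r\<^sup>2 < 4 * s\<^sup>2"
  shows "d \<in> {sqrt (r\<^sup>2 / 4 + s\<^sup>2)..<thr_P r s} \<Longrightarrow>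
     (d3 \<in> {h - s..<thr_R r s d} \<longrightarrow> X = {S12p}) \<and>
     (d3 = thr_R r s d \<longrightarrow> X = {S12p, S23p, S31p}) \<and>
     (d3 \<in> {thr_R r s d<..sqrt (h\<^sup>2 + s\<^sup>2)} \<longrightarrow> X = {S23p, S31p})"
    and "d = thr_P r s \<Longrightarrow>
     (d3 \<in> {h - s..<sqrt (h\<^sup>2 - s\<^sup>2)} \<longrightarrow> X = {S12p}) \<and>
     (d3 = sqrt (h\<^sup>2 - s\<^sup>2) \<longrightarrow> X = {S12p, S23p, S23m, S31p, S31m}) \<and>
     (d3 \<in> {sqrt (h\<^sup>2 - s\<^sup>2)<..sqrt (h\<^sup>2 + s\<^sup>2)} \<longrightarrow> X = {S23p, S31p})"
    and "thr_P r s < d \<Longrightarrow>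
     (d3 \<in> {h - s<..<d3_star Z1 Z2 Z3 d} \<longrightarrow> X = {S12p}) \<and>
     (d3 = d3_star Z1 Z2 Z3 d \<longrightarrow> X = {S12p, S23m, S31m}) \<and>
     (d3 \<in> {d3_star Z1 Z2 Z3 d<..<sqrt (h\<^sup>2 - s\<^sup>2)} \<longrightarrow> X = {S23m, S31m}) \<and>
     (d3 = sqrt (h\<^sup>2 - s\<^sup>2) \<longrightarrow> X = {S23p, S23m, S31p, S31m}) \<and>
     (d3 \<in> {sqrt (h\<^sup>2 - s\<^sup>2)<..sqrt (h\<^sup>2 + s\<^sup>2)} \<longrightarrow> X = {S23p, S31p})"
    and "sqrt (r\<^sup>2 / 4 + s\<^sup>2) \<le> d \<Longrightarrow>
     (d3 \<in> {sqrt (h\<^sup>2 + s\<^sup>2)<..<thr_M r s d} \<longrightarrow> X = {S23p, S31p}) \<and>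
     (d3 = thr_M r s d \<longrightarrow> X = {S23p, S31p, S12m}) \<and>
     (d3 \<in> {thr_M r s d<..} \<longrightarrow> X = {S12m})"
proof -
  have K: "0 < K" using K_pos_tall[OF rs] .
  have le_sum: "d3 \<le> sqrt (h\<^sup>2 + s\<^sup>2) \<longleftrightarrow> 0 \<le> c" using d3_sqrt_sum by linarith
  \<comment> \<open>The ranges of d3 up to sqrt(h^2 + s^2) are those with c >= 0. As K > 0, they lie
    below M.\<close>
  have below_M: "d3 < thr_M r s d" if "0 \<le> c"
  proof -
    have "0 \<le> c * (4 * s\<^sup>2 + r\<^sup>2)" using that lead_pos by simp
    then show ?thesis unfolding d3_M using K by linarith
  qed
  have above_R: "thr_R r s d < d3" if "c < 0"
  proof -
    have "c * (4 * s\<^sup>2 + 9 * r\<^sup>2) < 0" using that lead9_pos by (rule mult_neg_pos)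
    then show ?thesis unfolding d3_R using K by linarith
  qed
  show "(d3 \<in> {h - s..<thr_R r s d} \<longrightarrow> X = {S12p}) \<and>
     (d3 = thr_R r s d \<longrightarrow> X = {S12p, S23p, S31p}) \<and>
     (d3 \<in> {thr_R r s d<..sqrt (h\<^sup>2 + s\<^sup>2)} \<longrightarrow> X = {S23p, S31p})"
    if "d \<in> {sqrt (r\<^sup>2 / 4 + s\<^sup>2)..<thr_P r s}"
  proof -
    have L: "s \<le> h" "L < 2 * s\<^sup>2 * (4 * s\<^sup>2 + r\<^sup>2)" using that d_P[OF rs] d_thresholds(1) by (auto simp flip: not_less)
    show ?thesis
      unfolding greaterThanAtMost_iff atLeastLessThan_iff le_sum
      using X_below_crossing[OF L(1) K L(2)] below_M by iprover
  qed
  show "(d3 \<in> {h - s..<sqrt (h\<^sup>2 - s\<^sup>2)} \<longrightarrow> X = {S12p}) \<and>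
     (d3 = sqrt (h\<^sup>2 - s\<^sup>2) \<longrightarrow> X = {S12p, S23p, S23m, S31p, S31m}) \<and>
     (d3 \<in> {sqrt (h\<^sup>2 - s\<^sup>2)<..sqrt (h\<^sup>2 + s\<^sup>2)} \<longrightarrow> X = {S23p, S31p})" if "d = thr_P r s"
  proof -
    have L: "L = 2 * s\<^sup>2 * (4 * s\<^sup>2 + r\<^sup>2)" using that d_P(2)[OF rs] by simp
    have "2 * s\<^sup>2 < c \<Longrightarrow> L < c * (4 * s\<^sup>2 + r\<^sup>2)" "c = 2 * s\<^sup>2 \<Longrightarrow> c * (4 * s\<^sup>2 + r\<^sup>2) = L"
      unfolding L cancel by simp_all
    then show ?thesis
      unfolding greaterThanAtMost_iff atLeastLessThan_iff le_sum d3_sqrt_diff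
      using X_above_crossing[OF rs eq_refl[OF L[symmetric]]] by iprover
  qed
  show "(d3 \<in> {h - s<..<d3_star Z1 Z2 Z3 d} \<longrightarrow> X = {S12p}) \<and>
     (d3 = d3_star Z1 Z2 Z3 d \<longrightarrow> X = {S12p, S23m, S31m}) \<and>
     (d3 \<in> {d3_star Z1 Z2 Z3 d<..<sqrt (h\<^sup>2 - s\<^sup>2)} \<longrightarrow> X = {S23m, S31m}) \<and>
     (d3 = sqrt (h\<^sup>2 - s\<^sup>2) \<longrightarrow> X = {S23p, S23m, S31p, S31m}) \<and>
     (d3 \<in> {sqrt (h\<^sup>2 - s\<^sup>2)<..sqrt (h\<^sup>2 + s\<^sup>2)} \<longrightarrow> X = {S23p, S31p})" if "thr_P r s < d"
  proof -
    have L: "2 * s\<^sup>2 * (4 * s\<^sup>2 + r\<^sup>2) < L" using that d_P(3)[OF rs] by simp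
    have "c * (4 * s\<^sup>2 + r\<^sup>2) = L \<Longrightarrow> 2 * s\<^sup>2 < c" "c = 2 * s\<^sup>2 \<Longrightarrow> c * (4 * s\<^sup>2 + r\<^sup>2) < L"
      using L cancel(1)[of "2 * s\<^sup>2" c] by auto
    then show ?thesis
      unfolding greaterThanAtMost_iff greaterThanLessThan_iff le_sum d3_sqrt_diff d3_D[OF rs L]
      using X_above_crossing[OF rs less_imp_le[OF L]] by iprover
  qed
  show "(d3 \<in> {sqrt (h\<^sup>2 + s\<^sup>2)<..<thr_M r s d} \<longrightarrow> X = {S23p, S31p}) \<and>
     (d3 = thr_M r s d \<longrightarrow> X = {S23p, S31p, S12m}) \<and>
     (d3 \<in> {thr_M r s d<..} \<longrightarrow> X = {S12m})" if "sqrt (r\<^sup>2 / 4 + s\<^sup>2) \<le> d"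
  proof -
    have sh: "s \<le> h" using that d_thresholds(1) by (simp flip: not_less)
    have "c < 0 \<Longrightarrow> c < 2 * s\<^sup>2" by (smt (verit) zero_le_power2)
    then have "X = {S23p, S31p}" if "c < 0" "d3 < thr_M r s d"
      using X_between[OF sh disjI2] above_R[unfolded d3_R] that(1) that(2)[unfolded d3_M] by iprover
    then show ?thesis
      unfolding greaterThanLessThan_iff greaterThan_iff d3_sqrt_sum d3_M(3)
      using X_at_M[OF sh K] X_above_M[OF sh K] by iprover
  qed
qed

end

section \<open>Classification\<close>

lemma isosceles_frame_exists:
  fixes Z1 Z2 Z3 :: "real^2"
  assumes triangle: "\<not> collinear {Z1, Z2, Z3}"
    and isosceles: "norm (Z1 - Z3) = norm (Z2 - Z3)"
  defines "r \<equiv> norm (Z1 - Z2)" and "s \<equiv> norm (Z3 - (1/2) *\<^sub>R (Z1 + Z2))"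
  obtains mid f g where "isosceles_frame f g r s"
    "Z1 = isosceles_frame.pt mid f g (- (r / 2)) 0" "Z2 = isosceles_frame.pt mid f g (r / 2) 0"
    "Z3 = isosceles_frame.pt mid f g 0 s"
proof -
  define mid where "mid = (1/2) *\<^sub>R (Z1 + Z2)"
  define f g where "f = (1 / r) *\<^sub>R (Z2 - Z1)" and "g = (1 / s) *\<^sub>R (Z3 - mid)"
  have "Z1 \<noteq> Z2" using triangle by auto
  then have r: "r > 0" by (simp add: r_def)
  have "Z3 \<noteq> mid"
  proof
    assume "Z3 = mid"
    then have "Z3 = midpoint Z1 Z2" by (simp add: mid_def midpoint_def)
    then have "collinear {Z1, Z2, Z3}" by (metis collinear_midpoint insert_commute)
    then show False using triangle by simp
  qed
  then have s: "s > 0" by (simp add: s_def mid_def)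
  have "(Z2 - Z1) \<bullet> (Z3 - mid) = 0"
  proof -
    have "(Z1 - Z3) \<bullet> (Z1 - Z3) = (Z2 - Z3) \<bullet> (Z2 - Z3)"
      using isosceles by (simp flip: power2_norm_eq_inner)
    then show ?thesis
      by (simp add: mid_def inner_diff_left inner_diff_right inner_add_right inner_commute)
  qed
  moreover have "(Z2 - Z1) \<bullet> (Z2 - Z1) = r\<^sup>2" "(Z3 - mid) \<bullet> (Z3 - mid) = s\<^sup>2"
    by (simp_all add: r_def s_def mid_def norm_minus_commute flip: power2_norm_eq_inner)
  ultimately have frame: "isosceles_frame f g r s"
    using r s by unfold_locales (simp_all add: f_def g_def power2_eq_square)
  show ?thesis
  proof (rule that[OF frame])
    show "Z1 = isosceles_frame.pt mid f g (- (r / 2)) 0" "Z2 = isosceles_frame.pt mid f g (r / 2) 0"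
      "Z3 = isosceles_frame.pt mid f g 0 s"
      unfolding isosceles_frame.pt_def[OF frame]
      using r s by (simp_all add: f_def g_def vec_eq_iff mid_def field_simps)
  qed
qed

theorem theorem15:
  fixes Z1 Z2 Z3 :: "real^2" and d1 d2 d3 :: real
    and r s h R M T P D :: real
    and Y0 Y3 N3 S12p S12m S23p S23m S31p S31m :: "real^2"
    and X :: "(real^2) set"
  assumes triangle: "\<not> collinear {Z1, Z2, Z3}"
    and isosceles: "norm (Z1 - Z3) = norm (Z2 - Z3)"
    and pos: "d1 > 0" "d2 > 0" "d3 > 0"
    and radii: "d1 = d2"
  defines "r \<equiv> norm (Z1 - Z2)"
    and "s \<equiv> norm (Z3 - (1/2) *\<^sub>R (Z1 + Z2))"
    and "X \<equiv> minimizers Z1 Z2 Z3 d1 d2 d3"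
    and "Y0 \<equiv> (1/3) *\<^sub>R (Z1 + Z2 + Z3)"
    and "Y3 \<equiv> Z1 + Z2 - Z3"
    and "N3 \<equiv> Z3 + (d3 / norm (Y3 - Z3)) *\<^sub>R (Y3 - Z3)"
    and "S12p \<equiv> near_point Z1 d1 Z2 d2 Z3"
    and "S12m \<equiv> far_point Z1 d1 Z2 d2 Z3"
    and "S23p \<equiv> near_point Z2 d2 Z3 d3 Z1"
    and "S23m \<equiv> far_point Z2 d2 Z3 d3 Z1"
    and "S31p \<equiv> near_point Z3 d3 Z1 d1 Z2"
    and "S31m \<equiv> far_point Z3 d3 Z1 d1 Z2"
    and "h \<equiv> thr_h r d1"
    and "R \<equiv> thr_R r s d1"
    and "M \<equiv> thr_M r s d1"
    and "T \<equiv> thr_T r s"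
    and "P \<equiv> thr_P r s"
    and "D \<equiv> d3_star Z1 Z2 Z3 d1"
  shows
    "((d1 \<in> {0<..sqrt (r\<^sup>2/4 + s\<^sup>2/9)} \<longrightarrow> d3 \<in> {0<..2 * s/3} \<longrightarrow> X = {Y0}) \<and>
      (d1 \<in> {0<..sqrt (r\<^sup>2/4 + s\<^sup>2)} \<longrightarrow> d3 \<in> {2 * s..} \<longrightarrow> X = {Y3}) \<and>
      (d1 \<in> {0<..r/2} \<longrightarrow> d3 \<in> {2 * s/3..2 * s} \<longrightarrow> X = {N3}) \<and>
      (d1 \<in> {r/2<..sqrt (r\<^sup>2/4 + s\<^sup>2/9)} \<longrightarrow> d3 \<in> {2 * s/3..s - h} \<longrightarrow> X = {N3}) \<and>
      (d1 \<in> {r/2<..sqrt (r\<^sup>2/4 + s\<^sup>2)} \<longrightarrow> d3 \<in> {s + h..2 * s} \<longrightarrow> X = {N3}) \<and>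
      (d1 \<in> {r/2<..<sqrt (r\<^sup>2/4 + s\<^sup>2/9)} \<longrightarrow> d3 \<in> {s - h<..<s + h} \<longrightarrow> X = {S23p, S31p}) \<and>
      (d1 \<in> {sqrt (r\<^sup>2/4 + s\<^sup>2/9)..} \<longrightarrow> d3 \<in> {0<..\<bar>s - h\<bar>} \<longrightarrow> X = {S12p}) \<and>
      (d1 \<in> {sqrt (r\<^sup>2/4 + s\<^sup>2/9)..<sqrt (r\<^sup>2/4 + s\<^sup>2)} \<longrightarrow>
         (d3 \<in> {s - h..<R} \<longrightarrow> X = {S12p}) \<and>
         (d3 = R \<longrightarrow> X = {S12p, S23p, S31p}) \<and>
         (d3 \<in> {R<..s + h} \<longrightarrow> X = {S23p, S31p}))) \<and>
     (s \<in> {0<..<sqrt 3 / 2 * r} \<longrightarrow>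
      (d1 \<in> {sqrt (r\<^sup>2/4 + s\<^sup>2)..<T} \<longrightarrow>
         (d3 \<in> {h - s..<R} \<longrightarrow> X = {S12p}) \<and>
         (d3 = R \<longrightarrow> X = {S12p, S23p, S31p}) \<and>
         (d3 \<in> {R<..<M} \<longrightarrow> X = {S23p, S31p}) \<and>
         (d3 = M \<longrightarrow> X = {S23p, S31p, S12m}) \<and>
         (d3 \<in> {M<..} \<longrightarrow> X = {S12m})) \<and>
      (d1 = T \<longrightarrow>
         (d3 \<in> {h - s..<sqrt (h\<^sup>2 + s\<^sup>2)} \<longrightarrow> X = {S12p}) \<and>
         (d3 = sqrt (h\<^sup>2 + s\<^sup>2) \<longrightarrow> X = {S12p, S12m, S23p, S31p}) \<and>
         (d3 \<in> {sqrt (h\<^sup>2 + s\<^sup>2)<..} \<longrightarrow> X = {S12m})) \<and>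
      (d1 \<in> {T<..} \<longrightarrow>
         (d3 \<in> {h - s..<sqrt (h\<^sup>2 + s\<^sup>2)} \<longrightarrow> X = {S12p}) \<and>
         (d3 = sqrt (h\<^sup>2 + s\<^sup>2) \<longrightarrow> X = {S12p, S12m}) \<and>
         (d3 \<in> {sqrt (h\<^sup>2 + s\<^sup>2)<..} \<longrightarrow> X = {S12m}))) \<and>
     (s \<in> {sqrt 3 / 2 * r<..} \<longrightarrow>
      (d1 \<in> {sqrt (r\<^sup>2/4 + s\<^sup>2)..<P} \<longrightarrow>
         (d3 \<in> {h - s..<R} \<longrightarrow> X = {S12p}) \<and>
         (d3 = R \<longrightarrow> X = {S12p, S23p, S31p}) \<and>
         (d3 \<in> {R<..sqrt (h\<^sup>2 + s\<^sup>2)} \<longrightarrow> X = {S23p, S31p})) \<and>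
      (d1 = P \<longrightarrow>
         (d3 \<in> {h - s..<sqrt (h\<^sup>2 - s\<^sup>2)} \<longrightarrow> X = {S12p}) \<and>
         (d3 = sqrt (h\<^sup>2 - s\<^sup>2) \<longrightarrow> X = {S12p, S23p, S23m, S31p, S31m}) \<and>
         (d3 \<in> {sqrt (h\<^sup>2 - s\<^sup>2)<..sqrt (h\<^sup>2 + s\<^sup>2)} \<longrightarrow> X = {S23p, S31p})) \<and>
      (d1 \<in> {P<..} \<longrightarrow>
         (d3 \<in> {h - s<..<D} \<longrightarrow> X = {S12p}) \<and>
         (d3 = D \<longrightarrow> X = {S12p, S23m, S31m}) \<and>
         (d3 \<in> {D<..<sqrt (h\<^sup>2 - s\<^sup>2)} \<longrightarrow> X = {S23m, S31m}) \<and>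
         (d3 = sqrt (h\<^sup>2 - s\<^sup>2) \<longrightarrow> X = {S23p, S23m, S31p, S31m}) \<and>
         (d3 \<in> {sqrt (h\<^sup>2 - s\<^sup>2)<..sqrt (h\<^sup>2 + s\<^sup>2)} \<longrightarrow> X = {S23p, S31p})) \<and>
      (d1 \<in> {sqrt (r\<^sup>2/4 + s\<^sup>2)..} \<longrightarrow>
         (d3 \<in> {sqrt (h\<^sup>2 + s\<^sup>2)<..<M} \<longrightarrow> X = {S23p, S31p}) \<and>
         (d3 = M \<longrightarrow> X = {S23p, S31p, S12m}) \<and>
         (d3 \<in> {M<..} \<longrightarrow> X = {S12m})))"
proof -
  obtain mid f g where frame: "isosceles_frame f g r s"
    and Z: "Z1 = isosceles_frame.pt mid f g (- (r / 2)) 0" "Z2 = isosceles_frame.pt mid f g (r / 2) 0"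
      "Z3 = isosceles_frame.pt mid f g 0 s"
    using isosceles_frame_exists[OF triangle isosceles, folded r_def s_def] by blast
  interpret F: isosceles_frame mid f g r s by (rule frame)
  have X: "X = minimizers F.Z1 F.Z2 F.Z3 d1 d1 d3"
    by (simp only: X_def Z radii)
  have S: "S12p = near_point F.Z1 d1 F.Z2 d1 F.Z3" "S12m = far_point F.Z1 d1 F.Z2 d1 F.Z3"
    "S23p = near_point F.Z2 d1 F.Z3 d3 F.Z1" "S23m = far_point F.Z2 d1 F.Z3 d3 F.Z1"
    "S31p = near_point F.Z3 d3 F.Z1 d1 F.Z2" "S31m = far_point F.Z3 d3 F.Z1 d1 F.Z2"
    unfolding S12p_def S12m_def S23p_def S23m_def S31p_def S31m_def Z radii by (rule refl)+
  have D: "D = d3_star F.Z1 F.Z2 F.Z3 d1"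
    by (simp only: D_def Z)
  have r: "r > 0" and s: "s > 0" using F.r_pos F.s_pos .
  have Y0: "Y0 = F.pt 0 (s / 3)" and Y3: "Y3 = F.pt 0 (- s)"
    unfolding Y0_def Y3_def Z F.pt_def by (simp_all add: vec_eq_iff field_simps)
  have N3: "N3 = F.pt 0 (s - d3)"
  proof -
    have "norm (Y3 - Z3) = 2 * s"
    proof -
      have "(norm (Y3 - Z3))\<^sup>2 = (2 * s)\<^sup>2" unfolding Y3 Z(3) F.norm_pt_diff by (simp add: power2_eq_square)
      then show ?thesis by (rule power2_eq_imp_eq) (use s in auto)
    qed
    moreover have "Y3 - Z3 = (2 * s) *\<^sub>R - g" unfolding Y3 Z(3) F.pt_def by (simp add: vec_eq_iff)
    ultimately have "N3 = Z3 + (d3 / (2 * s)) *\<^sub>R ((2 * s) *\<^sub>R - g)" by (simp only: N3_def)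
    then show ?thesis using s by (simp add: Z(3) F.pt_def algebra_simps)
  qed
  have sqrt_le: "d1\<^sup>2 \<le> z" if "d1 \<le> sqrt z" "0 \<le> z" for z
    using that pos(1) by (metis power_mono less_imp_le real_sqrt_pow2)
  have A1: "X = {Y0}" if "d1 \<in> {0<..sqrt (r\<^sup>2/4 + s\<^sup>2/9)}" "d3 \<in> {0<..2 * s/3}"
  proof -
    have "d1\<^sup>2 \<le> r\<^sup>2/4 + s\<^sup>2/9" using that sqrt_le by simp
    moreover have "d3\<^sup>2 \<le> (2 * s/3)\<^sup>2" using that pos by (intro power_mono) auto
    ultimately show ?thesis
      \<comment> \<open>With both multipliers 1 the combination is the sum of the squared distances
        up to a constant, whose minimum is at the centroid.\<close>
      unfolding X Y0 by (intro F.minimizers_axis[of 1 1]) (auto simp: power2_eq_square field_simps)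
  qed
  have A2: "X = {Y3}" if "d1 \<in> {0<..sqrt (r\<^sup>2/4 + s\<^sup>2)}" "d3 \<in> {2 * s..}"
  proof -
    have "d1\<^sup>2 \<le> r\<^sup>2/4 + s\<^sup>2" using that sqrt_le by simp
    moreover have "(2 * s)\<^sup>2 \<le> d3\<^sup>2" using that s by (intro power_mono) auto
    ultimately show ?thesis
      \<comment> \<open>The signs 1, 1, -1 give a quadratic with leading coefficient 1 and minimum
        at Z1 + Z2 - Z3.\<close>
      unfolding X Y3 by (intro F.minimizers_axis[of 1 "- 1"]) (auto simp: power2_eq_square field_simps)
  qed
  have A3: "X = {N3}" if "d1 \<in> {0<..r/2}" "d3 \<in> {2 * s/3..2 * s}"
  proof -
    have "d1\<^sup>2 \<le> (r/2)\<^sup>2" using that pos by (intro power_mono) auto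
    then have "d1\<^sup>2 \<le> r\<^sup>2/4 + (s - d3)\<^sup>2"
      by (simp add: power_divide add_increasing2)
    then show ?thesis unfolding X N3 using that by (intro F.minimizers_N3) auto
  qed
  have rs: "4 * s\<^sup>2 < 3 * r\<^sup>2" if "s \<in> {0<..<sqrt 3 / 2 * r}"
  proof -
    have "s\<^sup>2 < (sqrt 3 / 2 * r)\<^sup>2" using that by (intro power_strict_mono) auto
    then show ?thesis by (simp add: power_mult_distrib power_divide)
  qed
  have sr: "3 * r\<^sup>2 < 4 * s\<^sup>2" if "s \<in> {sqrt 3 / 2 * r<..}"
  proof -
    have "(sqrt 3 / 2 * r)\<^sup>2 < s\<^sup>2" using that r by (intro power_strict_mono) auto
    then show ?thesis by (simp add: power_mult_distrib power_divide)
  qed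
  show ?thesis
  proof (cases "r / 2 < d1")
    case True
    have "(r / 2)\<^sup>2 < d1\<^sup>2" using True r by (intro power_strict_mono) auto
    then have "0 < d1\<^sup>2 - r\<^sup>2 / 4" by (simp add: power_divide)
    then have "0 < h" "d1\<^sup>2 = h\<^sup>2 + r\<^sup>2 / 4" by (simp_all add: h_def thr_h_def)
    then interpret C: isosceles_circles mid f g r s d1 d3 h
      using pos by unfold_locales
    note A = C.classification_any_height[folded X S R_def N3] and B = C.classification_flat[OF rs, folded X S R_def M_def T_def]
      and C = C.classification_tall[OF sr, folded X S D R_def M_def P_def]
    have A4: "X = {N3}" if "d1 \<in> {r/2<..sqrt (r\<^sup>2/4 + s\<^sup>2/9)}" "d3 \<in> {2 * s/3..s - h}"
      using that A(1) by simp
    have A5: "X = {N3}" if "d1 \<in> {r/2<..sqrt (r\<^sup>2/4 + s\<^sup>2)}" "d3 \<in> {s + h..2 * s}"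
      using that A(2) by simp
    have A6: "X = {S23p, S31p}" if "d1 \<in> {r/2<..<sqrt (r\<^sup>2/4 + s\<^sup>2/9)}" "d3 \<in> {s - h<..<s + h}"
      using that(1) A(3)[OF _ that(2)] unfolding greaterThanLessThan_iff by iprover
    have A7: "X = {S12p}" if "d1 \<in> {sqrt (r\<^sup>2/4 + s\<^sup>2/9)..}" "d3 \<in> {0<..\<bar>s - h\<bar>}"
      using that(1) A(4)[OF _ that(2)] unfolding atLeast_iff by iprover
    note B3 = B(3)[folded greaterThan_iff[of d1 T]] and C3 = C(3)[folded greaterThan_iff[of d1 P]]
      and C4 = C(4)[folded atLeast_iff[of d1]]
    show ?thesis
      by (intro conjI impI;
          (erule (1) A1 | erule (1) A2 | erule (1) A3 | erule (1) A4 | erule (1) A5 | erule (1) A6 | erule (1) A7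
          | (drule A(5), elim conjE, erule (1) mp)
          | (drule (1) B(1), elim conjE, erule (1) mp) | (drule (1) B(2), elim conjE, erule (1) mp)
          | (drule (1) B3, elim conjE, erule (1) mp) | (drule (1) C(1), elim conjE, erule (1) mp)
          | (drule (1) C(2), elim conjE, erule (1) mp) | (drule (1) C3, elim conjE, erule (1) mp)
          | (drule (1) C4, elim conjE, erule (1) mp)))
  next
    case False
    \<comment> \<open>For d1 <= r/2 only the first three cases have content: every other range of d1
      begins at r/2, excluded, or at some sqrt(r^2/4 + z) with z > 0; T and P also have this
      form.\<close>
    have less: "d1 < sqrt (r\<^sup>2/4 + z)" if "0 < z" for z
    proof -
      have "sqrt ((r/2)\<^sup>2) < sqrt (r\<^sup>2/4 + z)" using that by (simp add: power_divide del: real_sqrt_abs)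
      then show ?thesis using False r by simp
    qed
    have A: "d1 < sqrt (r\<^sup>2/4 + s\<^sup>2/9)" "d1 < sqrt (r\<^sup>2/4 + s\<^sup>2)"
      using s by (auto intro: less)
    have T: "d1 < T" if "s \<in> {0<..<sqrt 3 / 2 * r}"
      unfolding T_def thr_T_def using rs[OF that] r s by (intro less mult_pos_pos) auto
    have P: "d1 < P" if "s \<in> {sqrt 3 / 2 * r<..}"
    proof -
      have "0 < (4 * s\<^sup>2 + 5 * r\<^sup>2) / (4 * s\<^sup>2 - 3 * r\<^sup>2)"
        using sr[OF that] r by (intro divide_pos_pos add_nonneg_pos) auto
      then show ?thesis
        unfolding P_def thr_P_def using s by (intro less mult_pos_pos zero_less_power)
    qed
    have outer: False if "d1 \<in> {r/2<..a}" for a using that False by simp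
    have outer': False if "d1 \<in> {r/2<..<a}" for a using that False by simp
    have inner: False if "d1 \<in> {sqrt (r\<^sup>2/4 + s\<^sup>2/9)..}" using that A(1) by simp
    have inner': False if "d1 \<in> {sqrt (r\<^sup>2/4 + s\<^sup>2/9)..<a}" for a using that A(1) by simp
    have high: False if "d1 \<in> {sqrt (r\<^sup>2/4 + s\<^sup>2)..}" using that A(2) by simp
    have high': False if "d1 \<in> {sqrt (r\<^sup>2/4 + s\<^sup>2)..<a}" for a using that A(2) by simp
    have noT: False if "s \<in> {0<..<sqrt 3 / 2 * r}" "d1 = T \<or> d1 \<in> {T<..}" using T[OF that(1)] that(2) by auto
    have noP: False if "s \<in> {sqrt 3 / 2 * r<..}" "d1 = P \<or> d1 \<in> {P<..}" using P[OF that(1)] that(2) by auto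
    show ?thesis
      by (intro conjI impI;
          (erule (1) A1 | erule (1) A2 | erule (1) A3
          | (drule outer, erule FalseE) | (drule outer', erule FalseE)
          | (drule inner, erule FalseE) | (drule inner', erule FalseE)
          | (drule high, erule FalseE) | (drule high', erule FalseE)
          | (drule noT, erule disjI1, erule FalseE) | (drule noT, erule disjI2, erule FalseE)
          | (drule noP, erule disjI1, erule FalseE) | (drule noP, erule disjI2, erule FalseE)))
  qed
qed

end
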